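(* The $G$-equivariant bijection $\varphi:\mathcal{L}\to X^0$ can be extended to a $G$-equivariant bijection $$\varphi:\overline{\mathcal{L}}\longrightarrow\overline{X}^0$$ in the following way: write $\{M\}\in\overline{\mathcal{L}}$ as $\{M\}=g\{L\}$ with $g\in G$ and $L=\sum_{i\in I}\pi^{k_i}Rv_i$ for some non-empty $I\subseteq\underline{n}$ and integers $k_i$. Then $$\varphi(\{M\})=g\Bigl(\sum_{i\in I}k_i(-\eta_i^I)\Bigr).$$
   Context: Setting. $K$ is a finite extension of $\mathbb{Q}_p$ with valuation ring $R$, prime element $\pi$ and valuation $v$ normalized by $v(\pi)=1$ (and $v(0)=\infty$); $V$ is an $n$-dimensional $K$-vector space with fixed basis $v_1,\dots,v_n$; $\underline{n}=\{1,\dots,n\}$. $G=PGL(V)$ denotes the group of $K$-rational points, with its $p$-adic topology. $T\subseteq G$ is the image of the diagonal matrices, $N\subseteq G$ is its normalizer, i.e. the image of the monomial matrices; $N=T\rtimes W$ with $W$ the group of permutation matrices, $w(v_i)=v_{w(i)}$. $\Lambda=X_*(T)\otimes\mathbb{R}=\sum_{i=1}^n\mathbb{R}\eta_i$ subject to the single relation $\sum_i\eta_i=0$. Roots: $\Phi=\{a_{ij}:i\neq j\}$, $a_{ij}(\sum x_k\eta_k)=x_i-x_j$. Compactified apartment. For nonempty $I\subseteq\underline{n}$ let $\Lambda_I=\sum_{i\in I}\mathbb{R}\eta_i^I$ with the single relation $\sum_{i\in I}\eta_i^I=0$, and $r_I:\Lambda\to\Lambda_I$, $r_I(\sum_{i=1}^n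 x_i\eta_i)=\sum_{i\in I}x_i\eta_i^I$; $\Lambda_{\underline{n}}=\Lambda$. $\overline{\Lambda}$ is the disjoint union $\bigcup_{\emptyset\ne I\subseteq\underline{n}}\Lambda_I$, with topology having as base the open subsets of $\Lambda$ together with the sets $C_U^I=(U+D_I)\cup\bigcup_{I\subseteq J\subsetneq\underline{n}}r_J(U+D_I)$ for nonempty $I\subsetneq\underline{n}$ and bounded open $U\subseteq\Lambda$, where $D_I=\sum_{i\notin I}\mathbb{R}_{\ge0}(-\eta_i)$. $N$ acts on $\overline{\Lambda}$ via $\nu$: $w\in W$ maps $\Lambda_I$ to $\Lambda_{w(I)}$ linearly by $\eta_i^I\mapsto\eta_{w(i)}^{w(I)}$, and $t\in T$ induced by $\mathrm{diag}(t_1,\dots,t_n)$ acts on $\Lambda_I$ by translation by $-\sum_{i\in I}v(t_i)\eta_i^I$. Groups. For $a=a_{ij}$, $U_a\subseteq G$ is the image of the group of unipotent matrices $v_j\mapsto v_j+\omega v_i$, $v_l\mapsto v_l$ ($l\ne j$), $\omega\in K$; $\psi_a(u)=v(\omega)$. For $x\in\overline{\Lambda}$, $f_x(a)=\inf\{t\in\mathbb{R}: x\in\overline{\{z\in\Lambda:a(z)\ge -t\}}\}$ (closure in $\overline{\Lambda}$; $\inf\emptyset=\infty$, $\inf\mathbb{R}=-\infty$), $U_{a,x}=\{u\in U_a:\psi_a(u)\ge f_x(a)\}$ (so it is $\{1\}$ if $f_x(a)=\infty$ and $U_a$ if $f_x(a)=-\infty$), $U_x$ is the subgroup of $G$ generated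 by all $U_{a,x}$, $a\in\Phi$; $N_x=\{n\in N:\nu(n)x=x\}$; $P_x=U_xN_x$ (a group). $Z\subseteq T$ is the subgroup of elements acting trivially on $\Lambda$, and $U_0^\wedge=U_0Z$, where $U_0=U_x$ for $x=0\in\Lambda$. Compactified building. $\overline{X}=(U_0^\wedge\times\overline{\Lambda})/\!\sim$, where $(g,x)\sim(h,y)$ iff there is $n\in N$ with $\nu(n)x=y$ and $g^{-1}hn\in P_x$. $G$ acts on $\overline{X}$: for $g\in G$ and $(v,x)\in U_0^\wedge\times\overline{\Lambda}$ write $gv=unh$ with $u\in U_0^\wedge$, $n\in N$, $h\in P_x$ (always possible) and set $g(v,x)=(u,\nu(n)x)$. $\overline{\Lambda}$ is embedded in $\overline{X}$ by $x\mapsto$ class of $(1,x)$. The building $X$ of $PGL(V)$ is $(G\times\Lambda)/\!\sim$ (same relation), identified with the subset $(U_0^\wedge\times\Lambda)/\!\sim$ of $\overline{X}$. Vertices. A point $x\in\Lambda_I\subseteq\overline{\Lambda}$ is a vertex if $x=\sum_{i\in I}x_i\eta_i^I$ with integers $x_i$. A point of $\overline{X}$ is a vertex if it is of the form $gx$ with $g\in G$ and $x$ a vertex in $\overline{\Lambda}$; $\overline{X}^0$ is the set of vertices of $\overline{X}$, and $X^0$ is the set of vertices of $X$ (the points $gx$ with $g\in G$ and $x$ a vertex in $\Lambda$). Lattices. An $R$-lattice in $V$ (of arbitrary positive rank) is a non-zero finitely generated $R$-submodule of $V$ (an $R$-lattice of full rank in the subspace it spans). Two lattices are equivalent if they differ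 by a factor in $K^\times$; $\{M\}$ is the class of $M$. $\overline{\mathcal{L}}$ is the set of classes of $R$-lattices of arbitrary positive rank, $\mathcal{L}\subseteq\overline{\mathcal{L}}$ the set of classes of lattices of full rank $n$; $G$ acts naturally on both. The known $G$-equivariant bijection $\varphi:\mathcal{L}\to X^0$ is given as follows: if $\{M\}=g\{L\}$ with $L=\sum_{i=1}^n\pi^{k_i}Rv_i$, then $\varphi(\{M\})=g\bigl(\sum_{i=1}^{n-1}(k_n-k_i)\eta_i\bigr)$. *)

theory Defs
  imports
    "HOL-Analysis.Analysis"
    "HOL-Algebra.Coset"
    "HOL-Algebra.Generated_Groups"
begin

section \<open>Finite extensions of the p-adic numbers\<close>

definition valuation_on :: "'k::field set \<Rightarrow> ('k \<Rightarrow> ereal) \<Rightarrow> bool" where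
  "valuation_on F w \<longleftrightarrow>
     (\<forall>x\<in>F. w x \<noteq> -\<infinity> \<and> (w x = \<infinity> \<longleftrightarrow> x = 0)) \<and>
     (\<forall>x\<in>F. \<forall>y\<in>F. w (x * y) = w x + w y \<and> min (w x) (w y) \<le> w (x + y))"

definition normalized_valuation :: "('k::field \<Rightarrow> ereal) \<Rightarrow> bool" where
  "normalized_valuation v \<longleftrightarrow>
     valuation_on UNIV v \<and> v ` (UNIV - {0}) = range (\<lambda>m::int. ereal (of_int m))"

definition padic_val :: "nat \<Rightarrow> rat \<Rightarrow> ereal" where
  "padic_val p q = (if q = 0 then \<infinity> else
     ereal (real (multiplicity (int p) (fst (quotient_of q)))
            - real (multiplicity (int p) (snd (quotient_of q)))))"

definition is_subfield :: "'k::field set \<Rightarrow> bool" where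
  "is_subfield F \<longleftrightarrow> 0 \<in> F \<and> 1 \<in> F \<and>
     (\<forall>x\<in>F. \<forall>y\<in>F. x + y \<in> F \<and> x * y \<in> F) \<and> (\<forall>x\<in>F. - x \<in> F \<and> inverse x \<in> F)"

definition val_Cauchy :: "('k::field \<Rightarrow> ereal) \<Rightarrow> (nat \<Rightarrow> 'k) \<Rightarrow> bool" where
  "val_Cauchy w s \<longleftrightarrow> (\<forall>C::real. \<exists>M. \<forall>i\<ge>M. \<forall>j\<ge>M. ereal C \<le> w (s i - s j))"

definition val_lim :: "('k::field \<Rightarrow> ereal) \<Rightarrow> (nat \<Rightarrow> 'k) \<Rightarrow> 'k \<Rightarrow> bool" where
  "val_lim w s l \<longleftrightarrow> (\<forall>C::real. \<exists>M. \<forall>i\<ge>M. ereal C \<le> w (s i - l))"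

text \<open>The subfield F with the valuation w is the completion of the rationals with respect to the
  p-adic valuation, i.e. a copy of the field of p-adic numbers.\<close>

definition is_Qp :: "nat \<Rightarrow> 'k::field_char_0 set \<Rightarrow> ('k \<Rightarrow> ereal) \<Rightarrow> bool" where
  "is_Qp p F w \<longleftrightarrow> is_subfield F \<and> valuation_on F w \<and>
     (\<forall>q. w (of_rat q) = padic_val p q) \<and>
     (\<forall>x\<in>F. \<exists>s. val_lim w (\<lambda>i. of_rat (s i)) x) \<and>
     (\<forall>s. range s \<subseteq> F \<and> val_Cauchy w s \<longrightarrow> (\<exists>l\<in>F. val_lim w s l))"

text \<open>The type \<open>'k\<close> is a finite extension of the p-adic numbers, and v is its normalized
  valuation, i.e. an integral multiple e (the ramification index) of an extension of the
  p-adic one.\<close>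

definition finite_extension_of_Qp :: "nat \<Rightarrow> ('k::field_char_0 \<Rightarrow> ereal) \<Rightarrow> bool" where
  "finite_extension_of_Qp p v \<longleftrightarrow> normalized_valuation v \<and>
     (\<exists>F w. is_Qp p F w \<and>
        (\<exists>e::nat. e > 0 \<and> (\<forall>x\<in>F. v x = ereal (real e) * w x)) \<and>
        (\<exists>B. finite B \<and> (\<forall>x. \<exists>c. (\<forall>b\<in>B. c b \<in> F) \<and> x = (\<Sum>b\<in>B. c b * b))))"


section \<open>The compactified apartment\<close>

text \<open>A point of the compactified apartment is encoded as a pair consisting of the index set I of
  its stratum and a coset. The point \<open>lam I x\<close> is \<open>\<Sum>i\<in>I. x i * \<eta>\<^sub>i\<^sup>I\<close>, where
  \<open>\<Sum>i\<in>I. \<eta>\<^sub>i\<^sup>I = 0\<close>: coordinates outside I are irrelevant, and those in I matter only up to a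
  common additive constant.\<close>

type_synonym apt_point = "nat set \<times> (nat \<Rightarrow> real) set"

definition lam :: "nat set \<Rightarrow> (nat \<Rightarrow> real) \<Rightarrow> apt_point" where
  "lam I x = (I, {y. \<exists>c. \<forall>i\<in>I. y i = x i + c})"

definition coords :: "apt_point \<Rightarrow> nat \<Rightarrow> real" where
  "coords q = (SOME x. q = lam (fst q) x)"

definition Lam :: "nat set \<Rightarrow> apt_point set" where
  "Lam I = range (lam I)"

definition Lam_bar :: "nat \<Rightarrow> apt_point set" where
  "Lam_bar n = (\<Union>I\<in>{I. I \<noteq> {} \<and> I \<subseteq> {1..n}}. Lam I)"

definition restr :: "nat set \<Rightarrow> apt_point \<Rightarrow> apt_point" where
  "restr I q = lam I (coords q)"

definition Lam_sum :: "nat \<Rightarrow> apt_point set \<Rightarrow> apt_point set \<Rightarrow> apt_point set" where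
  "Lam_sum n U D = {lam {1..n} (\<lambda>i. x i + y i) | x y. lam {1..n} x \<in> U \<and> lam {1..n} y \<in> D}"

definition D_cone :: "nat \<Rightarrow> nat set \<Rightarrow> apt_point set" where
  "D_cone n I = {lam {1..n} (\<lambda>i. if i \<in> I then 0 else - c i) | c. \<forall>i. 0 \<le> c i}"

text \<open>The stratum for \<open>{1..n}\<close> is a finite-dimensional real vector space; its usual topology is the
  quotient topology. The preimage below is a cylinder in the product space of all functions, so
  this is the same as being open in the n-dimensional coordinate space.\<close>

definition Lam_open :: "nat \<Rightarrow> apt_point set \<Rightarrow> bool" where
  "Lam_open n U \<longleftrightarrow> U \<subseteq> Lam {1..n} \<and> open {x. lam {1..n} x \<in> U}"

definition Lam_bounded :: "nat \<Rightarrow> apt_point set \<Rightarrow> bool" where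
  "Lam_bounded n U \<longleftrightarrow> (\<exists>B. U \<subseteq> lam {1..n} ` {x. \<forall>i\<in>{1..n}. \<bar>x i\<bar> \<le> B})"

definition C_set :: "nat \<Rightarrow> nat set \<Rightarrow> apt_point set \<Rightarrow> apt_point set" where
  "C_set n I U = Lam_sum n U (D_cone n I) \<union>
     (\<Union>J\<in>{J. I \<subseteq> J \<and> J \<subset> {1..n}}. restr J ` Lam_sum n U (D_cone n I))"

definition Lam_bar_topology :: "nat \<Rightarrow> apt_point topology" where
  "Lam_bar_topology n = topology_generated_by
     ({U. Lam_open n U} \<union>
      {C_set n I U | I U. I \<noteq> {} \<and> I \<subset> {1..n} \<and> Lam_open n U \<and> Lam_bounded n U})"

text \<open>The root \<open>a\<^sub>i\<^sub>j\<close> on the stratum for \<open>{1..n}\<close>.\<close>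

definition root_fun :: "nat \<Rightarrow> nat \<Rightarrow> apt_point \<Rightarrow> real" where
  "root_fun i j z = coords z i - coords z j"

definition f_fun :: "nat \<Rightarrow> apt_point \<Rightarrow> nat \<Rightarrow> nat \<Rightarrow> ereal" where
  "f_fun n x i j = Inf (ereal ` {t::real.
     x \<in> Lam_bar_topology n closure_of {z \<in> Lam {1..n}. root_fun i j z \<ge> - t}})"

definition apt_vertex :: "nat set \<Rightarrow> apt_point \<Rightarrow> bool" where
  "apt_vertex I x \<longleftrightarrow> (\<exists>k :: nat \<Rightarrow> int. x = lam I (\<lambda>i. real_of_int (k i)))"


section \<open>The group, the compactified building and lattices\<close>

text \<open>Parameters: v is the valuation of K, \<open>\<cdot>\<close> the scalar multiplication of V, and
  \<open>b 1, \<dots>, b n\<close> the fixed basis of V.\<close>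

context
  fixes v :: "'k::field \<Rightarrow> ereal"
    and smul :: "'k \<Rightarrow> 'v::ab_group_add \<Rightarrow> 'v" (infixr "\<cdot>" 75)
    and b :: "nat \<Rightarrow> 'v"
    and n :: nat
begin

definition GL :: "('v \<Rightarrow> 'v) monoid" where
  "GL = \<lparr>carrier = {A. Vector_Spaces.linear smul smul A \<and> bij A}, mult = (\<circ>), one = id\<rparr>"

definition scalars :: "('v \<Rightarrow> 'v) set" where
  "scalars = {(\<lambda>x. c \<cdot> x) | c. c \<noteq> 0}"

definition PGL :: "('v \<Rightarrow> 'v) set monoid" where
  "PGL = GL Mod scalars"

definition img :: "('v \<Rightarrow> 'v) \<Rightarrow> ('v \<Rightarrow> 'v) set" where
  "img A = scalars #>\<^bsub>GL\<^esub> A"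

text \<open>Elements of \<open>PGL\<close> are cosets of the group of scalars, and \<open>img A\<close> is the class of A.
  A represents the element \<open>t w\<close>, where t is diagonal with entries \<open>t i\<close> and w is a
  permutation matrix.\<close>

definition monomial :: "(nat \<Rightarrow> 'k) \<Rightarrow> (nat \<Rightarrow> nat) \<Rightarrow> ('v \<Rightarrow> 'v) \<Rightarrow> bool" where
  "monomial t w A \<longleftrightarrow> A \<in> carrier GL \<and> w permutes {1..n} \<and> (\<forall>i\<in>{1..n}. t i \<noteq> 0) \<and>
     (\<forall>i\<in>{1..n}. A (b i) = t (w i) \<cdot> b (w i))"

definition T_grp :: "('v \<Rightarrow> 'v) set set" where
  "T_grp = {img A | A t. monomial t id A}"

text \<open>The image of the monomial matrices; this is the normalizer of \<open>T_grp\<close>.\<close>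

definition N_grp :: "('v \<Rightarrow> 'v) set set" where
  "N_grp = {img A | A t w. monomial t w A}"

definition nu_perm :: "(nat \<Rightarrow> nat) \<Rightarrow> apt_point \<Rightarrow> apt_point" where
  "nu_perm w q = lam (w ` fst q) (\<lambda>j. coords q (inv_into UNIV w j))"

definition nu_diag :: "(nat \<Rightarrow> 'k) \<Rightarrow> apt_point \<Rightarrow> apt_point" where
  "nu_diag t q = lam (fst q) (\<lambda>i. coords q i - real_of_ereal (v (t i)))"

definition nu :: "('v \<Rightarrow> 'v) set \<Rightarrow> apt_point \<Rightarrow> apt_point" where
  "nu m q = (THE q'. \<exists>A t w. monomial t w A \<and> m = img A \<and> q' = nu_diag t (nu_perm w q))"

definition unipotent :: "nat \<Rightarrow> nat \<Rightarrow> 'k \<Rightarrow> ('v \<Rightarrow> 'v) \<Rightarrow> bool" where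
  "unipotent i j \<omega> A \<longleftrightarrow> A \<in> carrier GL \<and> A (b j) = b j + \<omega> \<cdot> b i \<and>
     (\<forall>l\<in>{1..n} - {j}. A (b l) = b l)"

definition U_root :: "nat \<Rightarrow> nat \<Rightarrow> apt_point \<Rightarrow> ('v \<Rightarrow> 'v) set set" where
  "U_root i j x = {img A | A \<omega>. unipotent i j \<omega> A \<and> f_fun n x i j \<le> v \<omega>}"

definition U_pt :: "apt_point \<Rightarrow> ('v \<Rightarrow> 'v) set set" where
  "U_pt x = generate PGL (\<Union>(i, j)\<in>{(i, j). i \<in> {1..n} \<and> j \<in> {1..n} \<and> i \<noteq> j}. U_root i j x)"

definition N_pt :: "apt_point \<Rightarrow> ('v \<Rightarrow> 'v) set set" where
  "N_pt x = {m \<in> N_grp. nu m x = x}"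

definition P_pt :: "apt_point \<Rightarrow> ('v \<Rightarrow> 'v) set set" where
  "P_pt x = U_pt x <#>\<^bsub>PGL\<^esub> N_pt x"

definition Z_grp :: "('v \<Rightarrow> 'v) set set" where
  "Z_grp = {t \<in> T_grp. \<forall>x\<in>Lam {1..n}. nu t x = x}"

definition U0_hat :: "('v \<Rightarrow> 'v) set set" where
  "U0_hat = U_pt (lam {1..n} (\<lambda>_. 0)) <#>\<^bsub>PGL\<^esub> Z_grp"

definition bld_rel :: "((('v \<Rightarrow> 'v) set \<times> apt_point) \<times> (('v \<Rightarrow> 'v) set \<times> apt_point)) set" where
  "bld_rel = {((g, x), (h, y)). g \<in> U0_hat \<and> h \<in> U0_hat \<and> x \<in> Lam_bar n \<and> y \<in> Lam_bar n \<and>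
     (\<exists>m\<in>N_grp. nu m x = y \<and> inv\<^bsub>PGL\<^esub> g \<otimes>\<^bsub>PGL\<^esub> h \<otimes>\<^bsub>PGL\<^esub> m \<in> P_pt x)}"

definition bld_bar :: "(('v \<Rightarrow> 'v) set \<times> apt_point) set set" where
  "bld_bar = (U0_hat \<times> Lam_bar n) // bld_rel"

text \<open>If \<open>(u0, x)\<close> represents the point and \<open>g u0 = u m h\<close>, then g maps it to the class of
  \<open>(u, nu m x)\<close>; the result does not depend on the choices.\<close>

definition bld_act ::
  "('v \<Rightarrow> 'v) set \<Rightarrow> (('v \<Rightarrow> 'v) set \<times> apt_point) set \<Rightarrow> (('v \<Rightarrow> 'v) set \<times> apt_point) set" where
  "bld_act g \<xi> = (THE \<zeta>. \<exists>u0 x u m h. (u0, x) \<in> \<xi> \<and> u \<in> U0_hat \<and> m \<in> N_grp \<and> h \<in> P_pt x \<and>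
     g \<otimes>\<^bsub>PGL\<^esub> u0 = u \<otimes>\<^bsub>PGL\<^esub> m \<otimes>\<^bsub>PGL\<^esub> h \<and> \<zeta> = bld_rel `` {(u, nu m x)})"

definition apt_embed :: "apt_point \<Rightarrow> (('v \<Rightarrow> 'v) set \<times> apt_point) set" where
  "apt_embed x = bld_rel `` {(\<one>\<^bsub>PGL\<^esub>, x)}"

definition vertices_bar :: "(('v \<Rightarrow> 'v) set \<times> apt_point) set set" where
  "vertices_bar = {\<xi> \<in> bld_bar. \<exists>g\<in>carrier PGL. \<exists>I x. I \<noteq> {} \<and> I \<subseteq> {1..n} \<and> apt_vertex I x \<and>
     \<xi> = bld_act g (apt_embed x)}"

definition vertices :: "(('v \<Rightarrow> 'v) set \<times> apt_point) set set" where
  "vertices = {\<xi> \<in> bld_bar. \<exists>g\<in>carrier PGL. \<exists>x. apt_vertex {1..n} x \<and> \<xi> = bld_act g (apt_embed x)}"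

definition val_ring :: "'k set" where
  "val_ring = {c. 0 \<le> v c}"

definition R_span :: "'v set \<Rightarrow> 'v set" where
  "R_span S = {(\<Sum>s\<in>S. c s \<cdot> s) | c. \<forall>s\<in>S. c s \<in> val_ring}"

definition R_lattice :: "'v set \<Rightarrow> bool" where
  "R_lattice M \<longleftrightarrow> M \<noteq> {0} \<and> (\<exists>S. finite S \<and> M = R_span S)"

definition homothety_class :: "'v set \<Rightarrow> 'v set set" where
  "homothety_class M = {(\<lambda>x. c \<cdot> x) ` M | c. c \<noteq> 0}"

definition lattice_classes_bar :: "'v set set set" where
  "lattice_classes_bar = {homothety_class M | M. R_lattice M}"

definition lattice_classes :: "'v set set set" where
  "lattice_classes = {homothety_class M | M. R_lattice M \<and> module.span smul M = UNIV}"

definition class_act :: "('v \<Rightarrow> 'v) set \<Rightarrow> 'v set set \<Rightarrow> 'v set set" where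
  "class_act g C = {A ` M | A M. A \<in> g \<and> M \<in> C}"

definition std_lattice :: "'k \<Rightarrow> nat set \<Rightarrow> (nat \<Rightarrow> int) \<Rightarrow> 'v set" where
  "std_lattice \<pi> I k = {(\<Sum>i\<in>I. (\<pi> powi k i * c i) \<cdot> b i) | c. \<forall>i\<in>I. c i \<in> val_ring}"

text \<open>The bijection from the classes of full-rank lattices to the vertices of the building; the
  coordinate vector is that of \<open>\<Sum>i=1..n-1. (k n - k i) * \<eta>\<^sub>i\<close>.\<close>

definition phi_full :: "'k \<Rightarrow> 'v set set \<Rightarrow> (('v \<Rightarrow> 'v) set \<times> apt_point) set" where
  "phi_full \<pi> C = (THE \<xi>. \<exists>g\<in>carrier PGL. \<exists>k.
     C = class_act g (homothety_class (std_lattice \<pi> {1..n} k)) \<and>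
     \<xi> = bld_act g (apt_embed (lam {1..n}
            (\<lambda>i. if i \<in> {1..n - 1} then real_of_int (k n - k i) else 0))))"

end

definition is_basis :: "('k::field \<Rightarrow> 'v::ab_group_add \<Rightarrow> 'v) \<Rightarrow> (nat \<Rightarrow> 'v) \<Rightarrow> nat \<Rightarrow> bool" where
  "is_basis smul b n \<longleftrightarrow> inj_on b {1..n} \<and> \<not> module.dependent smul (b ` {1..n}) \<and>
     module.span smul (b ` {1..n}) = UNIV"

end

theory Submission
  imports Defs
begin

text \<open>A vertex \<open>x = \<Sum>i\<in>I. k i * (- \<eta>\<^sub>i\<^sup>I)\<close> corresponds to the lattice with basis \<open>\<pi> powi k i \<cdot> b i\<close>, \<open>i \<in> I\<close>.
  The function \<open>f\<^sub>x\<close> takes the value \<open>-\<infinity>\<close> at \<open>a\<^sub>i\<^sub>j\<close> if \<open>j \<notin> I\<close>, \<open>\<infinity>\<close> if \<open>j \<in> I\<close> and \<open>i \<notin> I\<close>, and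
  \<open>k i - k j\<close> otherwise, so the generators of \<open>P\<^sub>x\<close> fix the class of this lattice. Conversely, Gaussian
  elimination turns any g mapping the lattice class of y to that of x into a monomial matrix, using
  only transvections from \<open>U\<^sub>x\<close>. Hence \<open>(u, x) \<sim> (h, y)\<close> holds for vertices if and only if u and h map
  the lattice classes of x and y to the same class. As every lattice is brought to standard form by
  elements of \<open>U\<^sub>0\<close>, vertices of the building are the same as lattice classes, equivariantly.\<close>

section \<open>Root functions at the boundary of the apartment\<close>

text \<open>\<open>nu\<close> and \<open>bld_act\<close> are definite descriptions, so a value must
  be shown to exist and to be independent of representatives. On vertices lattice classes serve as
  an invariant free of choices: two decompositions of one group element move a lattice to the same
  class, and a class of standard lattices determines its vertex. Existence of the decompositions
  comes from the elimination.

  The elimination stays inside the root groups at the target because of the order of columns and the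
  choice of pivots. Columns in the index set I of the source lattice come first. The remaining
  columns find their pivots in rows outside the index set J of the target, where the root functions
  impose no bound.\<close>

lemma lam_eq_iff: "lam I x = lam J y \<longleftrightarrow> I = J \<and> (\<exists>c. \<forall>i\<in>I. y i = x i + c)"
proof
  assume h: "lam I x = lam J y"
  hence IJ: "I = J" and "{z. \<exists>c. \<forall>i\<in>I. z i = x i + c} = {z. \<exists>c. \<forall>i\<in>J. z i = y i + c}"
    by (auto simp: lam_def)
  moreover have "y \<in> {z. \<exists>c. \<forall>i\<in>J. z i = y i + c}" by (auto intro: exI[of _ 0])
  ultimately show "I = J \<and> (\<exists>c. \<forall>i\<in>I. y i = x i + c)" by blast
next
  assume "I = J \<and> (\<exists>c. \<forall>i\<in>I. y i = x i + c)"
  then obtain c where IJ: "I = J" and c: "\<forall>i\<in>I. y i = x i + c" by blast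
  have "(\<exists>d. \<forall>i\<in>I. z i = x i + d) \<longleftrightarrow> (\<exists>d. \<forall>i\<in>I. z i = y i + d)" for z
  proof
    assume "\<exists>d. \<forall>i\<in>I. z i = x i + d"
    then obtain d where "\<forall>i\<in>I. z i = x i + d" by blast
    thus "\<exists>d. \<forall>i\<in>I. z i = y i + d" using c by (intro exI[of _ "d - c"]) auto
  next
    assume "\<exists>d. \<forall>i\<in>I. z i = y i + d"
    then obtain d where "\<forall>i\<in>I. z i = y i + d" by blast
    thus "\<exists>d. \<forall>i\<in>I. z i = x i + d" using c by (intro exI[of _ "d + c"]) auto
  qed
  thus "lam I x = lam J y" using IJ by (simp add: lam_def)
qed

lemma lam_cong: "(\<And>i. i \<in> I \<Longrightarrow> x i = y i) \<Longrightarrow> lam I x = lam I y"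
  by (auto simp: lam_eq_iff intro: exI[of _ 0])

lemma fst_lam [simp]: "fst (lam I x) = I"
  by (simp add: lam_def)

lemma lam_coords: "lam I (coords (lam I x)) = lam I x"
proof -
  have "\<exists>y. lam I x = lam (fst (lam I x)) y" by auto
  hence "lam I x = lam (fst (lam I x)) (coords (lam I x))" unfolding coords_def by (rule someI_ex)
  thus ?thesis by simp
qed

text \<open>\<open>coords\<close> picks a representative by choice, so its values are known only up
  to one additive constant; whatever is built on it has to be invariant under such a shift.\<close>

lemma coords_lam: obtains c where "\<And>i. i \<in> I \<Longrightarrow> coords (lam I x) i = x i + c"
  using lam_coords[of I x] lam_eq_iff by metis

lemma restr_lam: assumes "J \<subseteq> I" shows "restr J (lam I x) = lam J x"
proof -
  obtain c where "\<And>i. i \<in> I \<Longrightarrow> coords (lam I x) i = x i + c" using coords_lam by blast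
  hence "\<forall>i\<in>J. x i = coords (lam I x) i + (-c)" using assms by auto
  thus ?thesis unfolding restr_def lam_eq_iff by blast
qed

lemma root_fun_lam: "i \<in> I \<Longrightarrow> j \<in> I \<Longrightarrow> root_fun i j (lam I x) = x i - x j"
  using coords_lam[of I x] by (smt (verit) root_fun_def)

lemma Lam_sum_D_cone_iff:
  "lam {1..n} z \<in> Lam_sum n U (D_cone n I) \<longleftrightarrow>
    (\<exists>x c. lam {1..n} x \<in> U \<and> (\<forall>i. 0 \<le> c i) \<and> (\<forall>i\<in>{1..n}. z i = x i - (if i \<in> I then 0 else c i)))"
  (is "?L \<longleftrightarrow> ?R")
proof
  assume ?L
  then obtain x y where h: "lam {1..n} z = lam {1..n} (\<lambda>i. x i + y i)" "lam {1..n} x \<in> U"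
    and y: "lam {1..n} y \<in> D_cone n I" unfolding Lam_sum_def mem_Collect_eq by (elim exE conjE)
  obtain c where c: "lam {1..n} y = lam {1..n} (\<lambda>i. if i \<in> I then 0 else - c i)"
    "\<forall>i. 0 \<le> (c i :: real)"
    using y unfolding D_cone_def mem_Collect_eq by (elim exE conjE)
  obtain d where d: "\<forall>i\<in>{1..n}. x i + y i = z i + d"
    using h(1) unfolding lam_eq_iff by (elim exE conjE)
  obtain e where e: "\<forall>i\<in>{1..n}. (if i \<in> I then 0 else - c i) = y i + e"
    using c(1) unfolding lam_eq_iff by (elim exE conjE)
  \<comment> \<open>The given representatives match only up to d and e. Moving both constants into x
    does not change the point of U and makes all coordinates agree exactly.\<close>
  have "lam {1..n} (\<lambda>i. x i + (- e - d)) = lam {1..n} x"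
    by (auto simp: lam_eq_iff intro!: exI[of _ "e + d"])
  moreover have "\<forall>i\<in>{1..n}. z i = x i + (- e - d) - (if i \<in> I then 0 else c i)"
    using d e by (smt (verit))
  ultimately show ?R using h(2) c(2)
    by (intro exI[of _ "\<lambda>i. x i + (- e - d)"] exI[of _ c]) auto
next
  assume ?R
  then obtain x c where h: "lam {1..n} x \<in> U" "\<forall>i. 0 \<le> (c i :: real)"
    "\<forall>i\<in>{1..n}. z i = x i - (if i \<in> I then 0 else c i)" by blast
  let ?y = "\<lambda>i. if i \<in> I then 0 else - c i"
  have "lam {1..n} z = lam {1..n} (\<lambda>i. x i + ?y i)" using h(3) by (intro lam_cong) auto
  moreover have "lam {1..n} ?y \<in> D_cone n I" unfolding D_cone_def using h(2) by blast
  ultimately show ?L unfolding Lam_sum_def mem_Collect_eq using h(1)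
    by (intro exI[of _ x] exI[of _ ?y] conjI)
qed

section \<open>Basic neighbourhoods of points of the compactified apartment\<close>

definition lam_box :: "nat \<Rightarrow> (nat \<Rightarrow> real) \<Rightarrow> real \<Rightarrow> apt_point set" where
  "lam_box n x e = lam {1..n} ` {z. \<forall>k\<in>{1..n}. \<bar>z k - x k\<bar> < e}"

lemma Lam_open_box: "Lam_open n (lam_box n x e)"
proof -
  \<comment> \<open>A point lies in the box if one of its representatives does, so the preimage is a
    union over the shift c of sets cut out by finitely many open conditions on coordinates.\<close>
  have eq: "{z. lam {1..n} z \<in> lam_box n x e} = (\<Union>c. \<Inter>k\<in>{1..n}. {z. \<bar>z k + c - x k\<bar> < e})"
  proof (rule Set.set_eqI, rule iffI)
    fix z assume "z \<in> {z. lam {1..n} z \<in> lam_box n x e}"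
    then obtain y where y: "lam {1..n} z = lam {1..n} y" "\<forall>k\<in>{1..n}. \<bar>y k - x k\<bar> < e"
      unfolding lam_box_def by auto
    then obtain c where "\<forall>k\<in>{1..n}. y k = z k + c" using lam_eq_iff by blast
    thus "z \<in> (\<Union>c. \<Inter>k\<in>{1..n}. {z. \<bar>z k + c - x k\<bar> < e})" using y(2) by auto
  next
    fix z assume "z \<in> (\<Union>c. \<Inter>k\<in>{1..n}. {z. \<bar>z k + c - x k\<bar> < e})"
    then obtain c where "\<forall>k\<in>{1..n}. \<bar>z k + c - x k\<bar> < e" by auto
    moreover have "lam {1..n} z = lam {1..n} (\<lambda>k. z k + c)" by (auto simp: lam_eq_iff)
    ultimately show "z \<in> {z. lam {1..n} z \<in> lam_box n x e}"
      unfolding lam_box_def by (auto intro!: image_eqI[of _ _ "\<lambda>k. z k + c"])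
  qed
  have "open {z :: nat \<Rightarrow> real. \<bar>z k + c - x k\<bar> < e}" for k c
    by (intro open_Collect_less continuous_intros continuous_on_product_coordinates)
  hence "open (\<Union>c. \<Inter>k\<in>{1..n}. {z :: nat \<Rightarrow> real. \<bar>z k + c - x k\<bar> < e})"
    by (intro open_UN ballI open_INT) auto
  thus ?thesis unfolding Lam_open_def eq by (auto simp: lam_box_def Lam_def)
qed

lemma Lam_bounded_box: "Lam_bounded n (lam_box n x e)"
proof -
  have "\<bar>z i\<bar> \<le> (\<Sum>k\<in>{1..n}. \<bar>x k\<bar>) + e"
    if "\<forall>k\<in>{1..n}. \<bar>z k - x k\<bar> < e" "i \<in> {1..n}" for z i
  proof -
    have "\<bar>x i\<bar> \<le> (\<Sum>k\<in>{1..n}. \<bar>x k\<bar>)" using that(2) by (intro member_le_sum) auto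
    moreover have "\<bar>z i - x i\<bar> < e" using that by blast
    ultimately show ?thesis by linarith
  qed
  thus ?thesis unfolding Lam_bounded_def lam_box_def
    by (intro exI[of _ "(\<Sum>k\<in>{1..n}. \<bar>x k\<bar>) + e"] image_mono) auto
qed

text \<open>The base sets \<open>C_set n I U\<close> are available for proper I only, so a point of
  the full stratum gets the box itself.\<close>

definition nbhd :: "nat \<Rightarrow> nat set \<Rightarrow> (nat \<Rightarrow> real) \<Rightarrow> real \<Rightarrow> apt_point set" where
  "nbhd n I x e = (if I = {1..n} then lam_box n x e else C_set n I (lam_box n x e))"

lemma openin_nbhd:
  assumes "I \<noteq> {}" "I \<subseteq> {1..n}" shows "openin (Lam_bar_topology n) (nbhd n I x e)"
  unfolding Lam_bar_topology_def
proof (rule topology_generated_by_Basis)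
  show "nbhd n I x e \<in> {U. Lam_open n U} \<union>
      {C_set n I U | I U. I \<noteq> {} \<and> I \<subset> {1..n} \<and> Lam_open n U \<and> Lam_bounded n U}"
    using assms Lam_open_box[of n x e] Lam_bounded_box[of n x e] by (auto simp: nbhd_def)
qed

lemma in_nbhd:
  assumes "I \<subseteq> {1..n}" "0 < e" shows "lam I x \<in> nbhd n I x e"
proof (cases "I = {1..n}")
  case True
  thus ?thesis using assms by (auto simp: nbhd_def lam_box_def)
next
  case False
  have "lam {1..n} x \<in> lam_box n x e" using assms by (auto simp: lam_box_def)
  hence "lam {1..n} x \<in> Lam_sum n (lam_box n x e) (D_cone n I)"
    unfolding Lam_sum_D_cone_iff by (intro exI[of _ x] exI[of _ "\<lambda>_. 0"]) auto
  hence "lam I x \<in> restr I ` Lam_sum n (lam_box n x e) (D_cone n I)"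
    using restr_lam[OF assms(1)] by (metis imageI)
  moreover have "I \<in> {J. I \<subseteq> J \<and> J \<subset> {1..n}}" using assms False by auto
  ultimately have "lam I x \<in> C_set n I (lam_box n x e)" unfolding C_set_def by blast
  thus ?thesis using False by (simp add: nbhd_def)
qed

text \<open>Adding an element of the cone lowers coordinates outside I and keeps those in I. As j
  lies in I, this can only decrease the root, so it exceeds its value at x by less than the e that
  the box allows for each of the two coordinates.\<close>

lemma nbhd_root_bound:
  assumes "lam {1..n} z \<in> nbhd n I x e" "i \<in> {1..n}" "j \<in> {1..n}" "j \<in> I"
  shows "z i - z j < x i - x j + 2 * e"
proof -
  have box: "y i - y j < x i - x j + 2 * e" if "lam {1..n} y \<in> lam_box n x e" for y
  proof -
    obtain y' where y': "lam {1..n} y = lam {1..n} y'" "\<forall>k\<in>{1..n}. \<bar>y' k - x k\<bar> < e"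
      using \<open>lam {1..n} y \<in> lam_box n x e\<close> by (auto simp: lam_box_def)
    obtain c where "\<forall>k\<in>{1..n}. y' k = y k + c" using y'(1) lam_eq_iff by blast
    hence "y' i = y i + c" "y' j = y j + c" using assms by auto
    moreover have "\<bar>y' i - x i\<bar> < e" "\<bar>y' j - x j\<bar> < e" using assms y'(2) by auto
    ultimately show ?thesis by linarith
  qed
  show ?thesis
  proof (cases "I = {1..n}")
    case True
    thus ?thesis using box assms(1) by (simp add: nbhd_def)
  next
    case False
    \<comment> \<open>The points \<open>restr J q\<close> with J proper lie in other strata.\<close>
    have "lam {1..n} z \<in> Lam_sum n (lam_box n x e) (D_cone n I)"
    proof (rule ccontr)
      assume "\<not> ?thesis"
      then obtain J q where "J \<subset> {1..n}" "lam {1..n} z = restr J q"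
        using assms(1) False by (auto simp: nbhd_def C_set_def)
      thus False unfolding restr_def using lam_eq_iff by blast
    qed
    then obtain y c where y: "lam {1..n} y \<in> lam_box n x e" "\<forall>i. 0 \<le> (c i :: real)"
      "\<forall>i\<in>{1..n}. z i = y i - (if i \<in> I then 0 else c i)"
      unfolding Lam_sum_D_cone_iff by blast
    have "z j = y j" "z i \<le> y i" using y assms by auto
    thus ?thesis using box[OF y(1)] by linarith
  qed
qed

text \<open>Moving the coordinates outside I to minus infinity converges to the stratum of I.\<close>

lemma eventually_in_open:
  assumes W: "openin (Lam_bar_topology n) W" and "lam I x \<in> W" and I: "I \<subseteq> {1..n}"
  shows "eventually (\<lambda>m. lam {1..n} (\<lambda>i. if i \<in> I then x i else y i - real m) \<in> W) sequentially"
proof -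
  let ?z = "\<lambda>m i. if i \<in> I then x i else y i - real m"
  let ?S = "{U. Lam_open n U} \<union>
      {C_set n I U | I U. I \<noteq> {} \<and> I \<subset> {1..n} \<and> Lam_open n U \<and> Lam_bounded n U}"
  have full: "lam {1..n} (?z m) = lam I x" if "I = {1..n}" for m
    using that by (auto intro!: lam_cong)
  have "generate_topology_on ?S W"
    using W by (simp add: Lam_bar_topology_def openin_topology_generated_by_iff)
  hence "lam I x \<in> W \<longrightarrow> eventually (\<lambda>m. lam {1..n} (?z m) \<in> W) sequentially"
  proof (induction rule: generate_topology_on.induct)
    case Empty
    show ?case by simp
  next
    case (Int a b)
    thus ?case by (auto intro: eventually_conj)
  next
    case (UN K)
    show ?case
    proof
      assume "lam I x \<in> \<Union>K"
      then obtain k where k: "k \<in> K" "lam I x \<in> k" by blast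
      hence "eventually (\<lambda>m. lam {1..n} (?z m) \<in> k) sequentially" using UN by blast
      thus "eventually (\<lambda>m. lam {1..n} (?z m) \<in> \<Union>K) sequentially"
        by (rule eventually_mono) (use k in blast)
    qed
  next
    case (Basis s)
    show ?case
    proof
      assume x: "lam I x \<in> s"
      show "eventually (\<lambda>m. lam {1..n} (?z m) \<in> s) sequentially"
      proof (cases "I = {1..n}")
        case True
        thus ?thesis using x full by simp
      next
        case False
        have "\<not> Lam_open n s"
          using x False by (auto simp: Lam_open_def Lam_def lam_eq_iff)
        then obtain I' U where s: "s = C_set n I' U" "I' \<noteq> {}" "I' \<subset> {1..n}"
          using Basis by auto
        have "lam I x \<notin> Lam_sum n U (D_cone n I')"
          using False by (auto simp: Lam_sum_def lam_eq_iff)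
        then obtain J q where J: "I' \<subseteq> J" "J \<subset> {1..n}" "q \<in> Lam_sum n U (D_cone n I')"
          "lam I x = restr J q" using x s by (auto simp: C_set_def)
        have JI: "J = I" using J(4) by (simp add: restr_def lam_eq_iff)
        obtain q' where q': "q = lam {1..n} q'" using J(3) by (auto simp: Lam_sum_def)
        obtain u c where u: "lam {1..n} u \<in> U" "\<forall>i. 0 \<le> (c i :: real)"
          "\<forall>i\<in>{1..n}. q' i = u i - (if i \<in> I' then 0 else c i)"
          using J(3) unfolding q' Lam_sum_D_cone_iff by blast
        have "lam I x = lam I q'" using J(4) q' restr_lam I JI by auto
        then obtain d where d: "\<forall>i\<in>I. q' i = x i + d" using lam_eq_iff by blast
        have "eventually (\<lambda>m. (\<Sum>i\<in>{1..n}. \<bar>u i - d - y i\<bar>) \<le> real m) sequentially"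
          by (rule eventually_sequentiallyI[of "nat \<lceil>\<Sum>i\<in>{1..n}. \<bar>u i - d - y i\<bar>\<rceil>"]) linarith
        thus ?thesis
        proof (rule eventually_mono)
          fix m assume m: "(\<Sum>i\<in>{1..n}. \<bar>u i - d - y i\<bar>) \<le> real m"
          \<comment> \<open>Outside I the cone coefficient is forced by the sequence: subtracted
            from \<open>u i - d\<close> it must leave \<open>y i - real m\<close>. It is
            non-negative once m is at least the sum, which bounds every single term. Inside I the
            coefficient c of the limit point is kept.\<close>
          define c' where "c' i = (if i \<in> I then c i else if i \<in> {1..n} then u i - d - y i + real m else 0)" for i
          have c'0: "0 \<le> c' i" for i
          proof (cases "i \<in> I \<or> i \<notin> {1..n}")
            case False
            hence "\<bar>u i - d - y i\<bar> \<le> (\<Sum>i\<in>{1..n}. \<bar>u i - d - y i\<bar>)" by (intro member_le_sum) auto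
            hence "0 \<le> u i - d - y i + real m" using m by linarith
            thus ?thesis using False by (simp add: c'_def)
          qed (use u(2) in \<open>auto simp: c'_def\<close>)
          have "\<forall>i\<in>{1..n}. ?z m i = (u i - d) - (if i \<in> I' then 0 else c' i)"
          proof
            fix i assume i: "i \<in> {1..n}"
            show "?z m i = (u i - d) - (if i \<in> I' then 0 else c' i)"
            proof (cases "i \<in> I")
              case True
              hence "q' i = x i + d" using d by blast
              thus ?thesis using True u(3) i by (auto simp: c'_def split: if_splits)
            next
              case False
              hence "i \<notin> I'" using J(1) JI by blast
              thus ?thesis using False i by (simp add: c'_def)
            qed
          qed
          moreover have "lam {1..n} (\<lambda>i. u i - d) = lam {1..n} u" by (auto simp: lam_eq_iff)
          ultimately have "lam {1..n} (?z m) \<in> Lam_sum n U (D_cone n I')"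
            unfolding Lam_sum_D_cone_iff using c'0 u(1)
            by (intro exI[of _ "\<lambda>i. u i - d"] exI[of _ c']) auto
          thus "lam {1..n} (?z m) \<in> s" unfolding s(1) C_set_def by blast
        qed
      qed
    qed
  qed
  thus ?thesis using assms by blast
qed

text \<open>Approaching the stratum of I sends the coordinates outside I to minus infinity. If j is
  outside I, the root can thus be kept above any bound; if only j is in I, it tends to minus
  infinity; if both indices are in I, it tends to \<open>x i - x j\<close>.\<close>

lemma in_closure_half_space_iff:
  assumes I: "I \<noteq> {}" "I \<subseteq> {1..n}" and i: "i \<in> {1..n}" and j: "j \<in> {1..n}" and "i \<noteq> j"
  shows "lam I x \<in> Lam_bar_topology n closure_of {z \<in> Lam {1..n}. root_fun i j z \<ge> - t} \<longleftrightarrow>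
    (j \<in> I \<longrightarrow> i \<in> I \<and> - t \<le> x i - x j)"
    (is "_ \<in> _ closure_of ?H \<longleftrightarrow> ?R")
proof
  assume cl: "lam I x \<in> Lam_bar_topology n closure_of ?H"
  show ?R
  proof (rule ccontr)
    assume neg: "\<not> ?R"
    hence jI: "j \<in> I" by blast
    \<comment> \<open>If i is outside I, its coordinate in the representative is free and is set so
      that the root has the value - t - 1. The radius e is half the gap to - t, which the
      \<open>2 * e\<close> of \<open>nbhd_root_bound\<close> then exactly fills.\<close>
    define y where "y = (if i \<in> I then x else x(i := x j - t - 1))"
    define e where "e = (- t - (y i - y j)) / 2"
    have e: "0 < e" using neg assms(5) by (auto simp: e_def y_def)
    have "lam I x = lam I y" by (rule lam_cong) (auto simp: y_def)
    hence "lam I x \<in> nbhd n I y e" using in_nbhd[OF I(2) e] by simp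
    then obtain q where q: "q \<in> ?H" "q \<in> nbhd n I y e"
      using cl openin_nbhd[OF I] unfolding in_closure_of by blast
    then obtain z where z: "q = lam {1..n} z" by (auto simp: Lam_def)
    have "z i - z j < y i - y j + 2 * e" using nbhd_root_bound q(2) z i j jI by blast
    moreover have "- t \<le> z i - z j" using q(1) z root_fun_lam[OF i j] by auto
    ultimately show False by (simp add: e_def field_simps)
  qed
next
  assume R: ?R
  \<comment> \<open>If neither index is in I, both coordinates descend at the same speed and the
    root keeps the value - t. If only i is in I, the root equals \<open>x i + real m\<close> and
    reaches - t at the threshold used below.\<close>
  define y where "y = (\<lambda>_::nat. 0::real)(i := - t)"
  let ?z = "\<lambda>m i. if i \<in> I then x i else y i - real m"
  have H: "eventually (\<lambda>m. lam {1..n} (?z m) \<in> ?H) sequentially"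
  proof (rule eventually_sequentiallyI[of "nat \<lceil>- t - x i\<rceil>"])
    fix m assume m: "nat \<lceil>- t - x i\<rceil> \<le> m"
    hence "- t - x i \<le> real m" by linarith
    hence "- t \<le> ?z m i - ?z m j" using R \<open>i \<noteq> j\<close> by (auto simp: y_def)
    thus "lam {1..n} (?z m) \<in> ?H" unfolding mem_Collect_eq root_fun_lam[OF i j] by (auto simp: Lam_def)
  qed
  show "lam I x \<in> Lam_bar_topology n closure_of ?H"
    unfolding in_closure_of
  proof (intro conjI allI impI)
    show "lam I x \<in> topspace (Lam_bar_topology n)"
      using openin_nbhd[OF I] in_nbhd[OF I(2) zero_less_one] openin_subset by blast
  next
    fix W assume "lam I x \<in> W \<and> openin (Lam_bar_topology n) W"
    hence "eventually (\<lambda>m. lam {1..n} (?z m) \<in> W) sequentially"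
      using eventually_in_open I by blast
    hence "eventually (\<lambda>m. lam {1..n} (?z m) \<in> W \<and> lam {1..n} (?z m) \<in> ?H) sequentially"
      using H by (rule eventually_conj)
    hence "\<exists>m. lam {1..n} (?z m) \<in> W \<and> lam {1..n} (?z m) \<in> ?H"
      by (intro eventually_happens'[of sequentially]) auto
    thus "\<exists>q. q \<in> ?H \<and> q \<in> W" by blast
  qed
qed

lemma f_fun_lam:
  assumes "I \<noteq> {}" "I \<subseteq> {1..n}" "i \<in> {1..n}" "j \<in> {1..n}" "i \<noteq> j"
  shows "f_fun n (lam I x) i j =
    (if j \<notin> I then - \<infinity> else if i \<notin> I then \<infinity> else ereal (x j - x i))"
proof -
  have eq: "{t. lam I x \<in> Lam_bar_topology n closure_of {z \<in> Lam {1..n}. root_fun i j z \<ge> - t}}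
    = {t. j \<in> I \<longrightarrow> i \<in> I \<and> x j - x i \<le> t}"
    using in_closure_half_space_iff[OF assms] by (smt (verit) Collect_cong)
  have all: "Inf (range ereal) = - \<infinity>"
  proof (rule ereal_bot)
    fix B show "Inf (range ereal) \<le> ereal B" by (intro Inf_lower) auto
  qed
  have "Inf (ereal ` {t. x j - x i \<le> t}) = ereal (x j - x i)"
    by (intro Inf_eqI) auto
  thus ?thesis unfolding f_fun_def eq using all by (auto simp: top_ereal_def)
qed

section \<open>Lattices and vertices\<close>

locale pgl_lattices = vector_space smul
  for smul :: "'k::field \<Rightarrow> 'v::ab_group_add \<Rightarrow> 'v" (infixr "\<cdot>" 75) +
  fixes v :: "'k \<Rightarrow> ereal" and \<pi> :: 'k and b :: "nat \<Rightarrow> 'v" and n :: nat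
  assumes valuation: "normalized_valuation v" and v_pi: "v \<pi> = 1"
    and n_pos: "1 \<le> n" and basis: "is_basis smul b n"
begin

declare One_nat_def [simp del]

section \<open>The valuation as an integer-valued order\<close>

definition ord :: "'k \<Rightarrow> int" where
  "ord a = (SOME m. v a = ereal (of_int m))"

lemma v_zero [simp]: "v 0 = \<infinity>"
  using valuation by (auto simp: normalized_valuation_def valuation_on_def)

lemma v_mult: "v (x * y) = v x + v y" and v_add: "min (v x) (v y) \<le> v (x + y)"
  using valuation by (auto simp: normalized_valuation_def valuation_on_def)

lemma v_ord: "a \<noteq> 0 \<Longrightarrow> v a = ereal (of_int (ord a))"
proof -
  assume "a \<noteq> 0"
  hence "v a \<in> range (\<lambda>m::int. ereal (of_int m))"
    using valuation unfolding normalized_valuation_def by blast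
  hence "\<exists>m. v a = ereal (of_int m)" by auto
  thus ?thesis unfolding ord_def by (rule someI_ex)
qed

lemma ord_eqI: "v a = ereal (of_int m) \<Longrightarrow> ord a = m"
  using v_ord[of a] by (cases "a = 0") auto

lemma ord_mult: "a \<noteq> 0 \<Longrightarrow> c \<noteq> 0 \<Longrightarrow> ord (a * c) = ord a + ord c"
  by (rule ord_eqI) (simp add: v_mult v_ord)

lemma ord_one [simp]: "ord 1 = 0"
  using ord_mult[of 1 1] by simp

lemma ord_minus [simp]: "ord (- a) = ord a"
proof (cases "a = 0")
  case False
  have "ord (-1) = 0" using ord_mult[of "-1" "-1"] by simp
  thus ?thesis using ord_mult[of "-1" a] False by simp
qed simp

lemma ord_inverse: "a \<noteq> 0 \<Longrightarrow> ord (inverse a) = - ord a"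
  using ord_mult[of a "inverse a"] by simp

lemma ord_divide: "a \<noteq> 0 \<Longrightarrow> c \<noteq> 0 \<Longrightarrow> ord (a / c) = ord a - ord c"
  by (simp add: divide_inverse ord_mult ord_inverse)

lemma pi_nonzero [simp]: "\<pi> \<noteq> 0"
  using v_pi by auto

lemma ord_pi [simp]: "ord \<pi> = 1"
  using v_pi by (intro ord_eqI) simp

lemma ord_power: "a \<noteq> 0 \<Longrightarrow> ord (a ^ m) = int m * ord a"
  by (induction m) (simp_all add: ord_mult algebra_simps)

lemma powi_pi_nonzero [simp]: "\<pi> powi m \<noteq> 0"
  by (simp add: power_int_not_zero)

lemma ord_powi [simp]: "ord (\<pi> powi m) = m"
proof (cases "0 \<le> m")
  case True
  thus ?thesis by (simp add: power_int_nonneg_exp ord_power)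
next
  case False
  hence "\<pi> powi m = inverse (\<pi> powi (- m))" by (simp add: power_int_minus)
  thus ?thesis using False by (simp add: power_int_nonneg_exp ord_power ord_inverse)
qed

text \<open>\<open>ord 0\<close> is an unspecified integer, so bounds on valuations are stated with
  this predicate, which 0 satisfies for every m because its valuation is infinite.\<close>

definition vge :: "int \<Rightarrow> 'k \<Rightarrow> bool" where
  "vge m a \<longleftrightarrow> (a \<noteq> 0 \<longrightarrow> m \<le> ord a)"

lemma vge_iff: "vge m a \<longleftrightarrow> ereal (of_int m) \<le> v a"
  by (cases "a = 0") (simp_all add: vge_def v_ord)

lemma vge_zero [simp]: "vge m 0"
  by (simp add: vge_def)

lemma vge_add: "vge m a \<Longrightarrow> vge m c \<Longrightarrow> vge m (a + c)"
  unfolding vge_iff using v_add[of a c] by (auto intro: order_trans simp: min_def split: if_splits)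

lemma vge_sum: "(\<And>i. i \<in> A \<Longrightarrow> vge m (f i)) \<Longrightarrow> vge m (sum f A)"
  by (induction A rule: infinite_finite_induct) (auto intro: vge_add)

lemma vge_mult: "vge m a \<Longrightarrow> vge l c \<Longrightarrow> vge (m + l) (a * c)"
  by (auto simp: vge_def ord_mult)

lemma vge_minus [simp]: "vge m (- a) = vge m a"
  by (simp add: vge_def)

lemma vge_mult_left: "a \<noteq> 0 \<Longrightarrow> vge m (a * c) \<longleftrightarrow> vge (m - ord a) c"
  by (auto simp: vge_def ord_mult)

lemma val_ring_iff: "c \<in> val_ring v \<longleftrightarrow> vge 0 c"
  by (simp add: val_ring_def vge_iff zero_ereal_def)

section \<open>Coordinates in the fixed basis\<close>

definition crd :: "'v \<Rightarrow> nat \<Rightarrow> 'k" where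
  "crd x i = representation (b ` {1..n}) x (b i)"

lemma b_indep: "independent (b ` {1..n})" and b_span: "span (b ` {1..n}) = UNIV"
  and b_inj: "inj_on b {1..n}"
  using basis by (simp_all add: is_basis_def)

lemma crd_add [simp]: "crd (x + y) i = crd x i + crd y i"
  by (simp add: crd_def representation_add[OF b_indep] b_span)

lemma crd_scale [simp]: "crd (c \<cdot> x) i = c * crd x i"
  by (simp add: crd_def representation_scale[OF b_indep] b_span)

lemma crd_zero [simp]: "crd 0 i = 0"
  by (simp add: crd_def representation_zero)

lemma crd_minus [simp]: "crd (- x) i = - crd x i"
  using crd_scale[of "-1" x i] by simp

lemma crd_diff [simp]: "crd (x - y) i = crd x i - crd y i"
  using crd_add[of x "-y" i] by simp

lemma crd_sum [simp]: "crd (sum f A) i = (\<Sum>a\<in>A. crd (f a) i)"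
  by (induction A rule: infinite_finite_induct) auto

lemma crd_b: "i \<in> {1..n} \<Longrightarrow> j \<in> {1..n} \<Longrightarrow> crd (b j) i = (if i = j then 1 else 0)"
  by (simp add: crd_def representation_basis[OF b_indep] inj_on_eq_iff[OF b_inj])

lemma expand: "(\<Sum>i\<in>{1..n}. crd x i \<cdot> b i) = x"
proof -
  have "(\<Sum>y\<in>b ` {1..n}. representation (b ` {1..n}) x y \<cdot> y) = x"
    by (rule sum_representation_eq[OF b_indep]) (auto simp: b_span)
  thus ?thesis by (simp add: sum.reindex[OF b_inj] crd_def)
qed

lemma vec_eqI: "(\<And>i. i \<in> {1..n} \<Longrightarrow> crd x i = crd y i) \<Longrightarrow> x = y"
  using expand[of x] expand[of y] by (metis (no_types, lifting) sum.cong)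

lemma crd_comb:
  assumes "A \<subseteq> {1..n}" "j \<in> {1..n}"
  shows "crd (\<Sum>i\<in>A. c i \<cdot> b i) j = (if j \<in> A then c j else 0)"
proof -
  have fA: "finite A" using assms finite_subset by blast
  have "crd (\<Sum>i\<in>A. c i \<cdot> b i) j = (\<Sum>i\<in>A. if j = i then c i else 0)"
    using assms by (auto simp: crd_b intro!: sum.cong)
  thus ?thesis using fA by simp
qed

lemma b_nonzero: "i \<in> {1..n} \<Longrightarrow> b i \<noteq> 0"
  using crd_b[of i i] by auto

subsection \<open>Linear automorphisms and the projective group\<close>

abbreviation "GLV \<equiv> carrier (GL smul)"

lemma GL_iff: "A \<in> GLV \<longleftrightarrow> (\<forall>x y. A (x + y) = A x + A y) \<and> (\<forall>c x. A (c \<cdot> x) = c \<cdot> A x) \<and> bij A"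
  by (auto simp: GL_def Vector_Spaces.linear_iff vector_space_axioms)

lemma GL_add: "A \<in> GLV \<Longrightarrow> A (x + y) = A x + A y"
  and GL_scale: "A \<in> GLV \<Longrightarrow> A (c \<cdot> x) = c \<cdot> A x"
  and GL_bij: "A \<in> GLV \<Longrightarrow> bij A"
  by (auto simp: GL_iff)

lemma GL_zero: "A \<in> GLV \<Longrightarrow> A 0 = 0"
  using GL_scale[of A 0 0] by simp

lemma GL_diff: "A \<in> GLV \<Longrightarrow> A (x - y) = A x - A y"
  using GL_add[of A "x - y" y] by simp

lemma GL_sum: "A \<in> GLV \<Longrightarrow> A (sum f S) = (\<Sum>s\<in>S. A (f s))"
  by (induction S rule: infinite_finite_induct) (auto simp: GL_zero GL_add)

lemma GL_inj: "A \<in> GLV \<Longrightarrow> A x = A y \<longleftrightarrow> x = y"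
  using GL_bij by (metis bij_pointE)

lemma GL_expand: "A \<in> GLV \<Longrightarrow> A x = (\<Sum>i\<in>{1..n}. crd x i \<cdot> A (b i))"
  using expand[of x] GL_sum[of A "\<lambda>i. crd x i \<cdot> b i" "{1..n}"] by (simp add: GL_scale)

lemma GL_eqI:
  assumes "A \<in> GLV" "B \<in> GLV" "\<And>i. i \<in> {1..n} \<Longrightarrow> A (b i) = B (b i)"
  shows "A = B"
proof
  fix x
  have "(\<Sum>i\<in>{1..n}. crd x i \<cdot> A (b i)) = (\<Sum>i\<in>{1..n}. crd x i \<cdot> B (b i))"
    using assms(3) by (intro sum.cong) auto
  thus "A x = B x" using GL_expand assms(1,2) by metis
qed

lemma GL_id: "id \<in> GLV"
  by (simp add: GL_iff)

lemma GL_comp: "A \<in> GLV \<Longrightarrow> B \<in> GLV \<Longrightarrow> A \<circ> B \<in> GLV"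
  by (auto simp: GL_iff intro: bij_comp)

lemma GL_inv: assumes "A \<in> GLV" shows "inv_into UNIV A \<in> GLV"
proof -
  have [simp]: "A (inv_into UNIV A x) = x" for x
    using GL_bij[OF assms] by (simp add: bij_is_surj surj_f_inv_f)
  show ?thesis unfolding GL_iff
  proof (intro conjI allI)
    fix x y show "inv_into UNIV A (x + y) = inv_into UNIV A x + inv_into UNIV A y"
      by (subst GL_inj[OF assms, symmetric]) (simp add: GL_add[OF assms])
  next
    fix c x show "inv_into UNIV A (c \<cdot> x) = c \<cdot> inv_into UNIV A x"
      by (subst GL_inj[OF assms, symmetric]) (simp add: GL_scale[OF assms])
  next
    show "bij (inv_into UNIV A)" using GL_bij[OF assms] by (rule bij_imp_bij_inv)
  qed
qed

lemma GL_inv_left: "A \<in> GLV \<Longrightarrow> inv_into UNIV A \<circ> A = id"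
  by (simp add: fun_eq_iff GL_bij bij_is_inj)

lemma GL_scalar: "c \<noteq> 0 \<Longrightarrow> (\<lambda>x. c \<cdot> x) \<in> GLV"
  unfolding GL_iff
proof (intro conjI allI)
  assume c: "c \<noteq> 0"
  show "bij (\<lambda>x. c \<cdot> x)"
    by (rule bij_betw_byWitness[where f' = "\<lambda>x. inverse c \<cdot> x"]) (use c in auto)
qed (auto simp: scale_right_distrib mult.commute)

lemma group_GL: "group (GL smul)"
proof (rule groupI)
  fix A assume A: "A \<in> GLV"
  show "\<exists>y\<in>GLV. y \<otimes>\<^bsub>GL smul\<^esub> A = \<one>\<^bsub>GL smul\<^esub>"
    using GL_inv[OF A] GL_inv_left[OF A] by (intro bexI[of _ "inv_into UNIV A"]) (simp_all add: GL_def)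
qed (use GL_comp GL_id in \<open>auto simp: GL_def comp_assoc\<close>)

lemma GL_mult [simp]: "A \<otimes>\<^bsub>GL smul\<^esub> B = A \<circ> B" and GL_one [simp]: "\<one>\<^bsub>GL smul\<^esub> = id"
  by (simp_all add: GL_def)

lemma normal_scalars: "scalars smul \<lhd> GL smul"
proof (rule group.normalI[OF group_GL])
  show "subgroup (scalars smul) (GL smul)"
  proof (rule group.subgroupI[OF group_GL])
    show "scalars smul \<subseteq> GLV" using GL_scalar by (auto simp: scalars_def)
    show "scalars smul \<noteq> {}" by (auto simp: scalars_def intro: exI[of _ 1])
  next
    fix A assume "A \<in> scalars smul"
    then obtain c where c: "c \<noteq> 0" "A = (\<lambda>x. c \<cdot> x)" by (auto simp: scalars_def)
    have "inv\<^bsub>GL smul\<^esub> A = (\<lambda>x. inverse c \<cdot> x)"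
      by (rule group.inv_equality[OF group_GL])
         (use c(1) GL_scalar in \<open>auto simp: c(2) GL_def fun_eq_iff simp del: GL_mult GL_one\<close>)
    thus "inv\<^bsub>GL smul\<^esub> A \<in> scalars smul"
      using c by (auto simp: scalars_def intro!: exI[of _ "inverse c"])
  next
    fix A B assume "A \<in> scalars smul" "B \<in> scalars smul"
    then obtain c d where "c \<noteq> 0" "A = (\<lambda>x. c \<cdot> x)" "d \<noteq> 0" "B = (\<lambda>x. d \<cdot> x)"
      by (auto simp: scalars_def)
    thus "A \<otimes>\<^bsub>GL smul\<^esub> B \<in> scalars smul"
      by (auto simp: scalars_def fun_eq_iff intro!: exI[of _ "c * d"])
  qed
  show "\<forall>A\<in>GLV. scalars smul #>\<^bsub>GL smul\<^esub> A = A <#\<^bsub>GL smul\<^esub> scalars smul"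
  proof
    fix A assume "A \<in> GLV"
    hence "S \<circ> A = A \<circ> S" if "S \<in> scalars smul" for S
      using that by (auto simp: scalars_def fun_eq_iff GL_scale)
    thus "scalars smul #>\<^bsub>GL smul\<^esub> A = A <#\<^bsub>GL smul\<^esub> scalars smul"
      by (auto simp: r_coset_def l_coset_def)
  qed
qed

abbreviation "G \<equiv> PGL smul"
abbreviation "im \<equiv> img smul"

lemma group_PGL: "group G"
  unfolding PGL_def by (rule normal.factorgroup_is_group[OF normal_scalars])

lemma im_eq: "im A = {(\<lambda>x. c \<cdot> A x) | c. c \<noteq> 0}"
  by (auto simp: img_def r_coset_def scalars_def fun_eq_iff)

lemma carrier_PGL: "carrier G = im ` GLV"
  by (auto simp: PGL_def FactGroup_def RCOSETS_def img_def)

lemma im_closed: "A \<in> GLV \<Longrightarrow> im A \<in> carrier G"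
  by (simp add: carrier_PGL)

lemma im_mult: "A \<in> GLV \<Longrightarrow> B \<in> GLV \<Longrightarrow> im A \<otimes>\<^bsub>G\<^esub> im B = im (A \<circ> B)"
  using normal.rcos_sum[OF normal_scalars] by (simp add: PGL_def FactGroup_def img_def)

lemma im_id: "\<one>\<^bsub>G\<^esub> = im id"
  by (auto simp: PGL_def FactGroup_def im_eq scalars_def)

lemma im_inv: "A \<in> GLV \<Longrightarrow> inv\<^bsub>G\<^esub> (im A) = im (inv_into UNIV A)"
  by (rule group.inv_equality[OF group_PGL])
     (simp_all add: im_mult im_closed GL_inv GL_inv_left im_id)

lemma im_eqD: "im A = im B \<Longrightarrow> \<exists>c. c \<noteq> 0 \<and> B = (\<lambda>x. c \<cdot> A x)"
proof -
  assume "im A = im B"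
  moreover have "B \<in> im B" by (auto simp: im_eq intro!: exI[of _ 1])
  ultimately show ?thesis by (auto simp: im_eq)
qed

section \<open>Homothety classes and the action of the group on them\<close>

abbreviation "cls \<equiv> homothety_class smul"

lemma cls_self: "M \<in> cls M"
  by (auto simp: homothety_class_def intro!: exI[of _ 1])

lemma cls_scale: "c \<noteq> 0 \<Longrightarrow> cls ((\<lambda>x. c \<cdot> x) ` M) = cls M"
proof -
  assume c: "c \<noteq> 0"
  have "(\<lambda>x. d \<cdot> x) ` M = (\<lambda>x. (d / c) \<cdot> x) ` (\<lambda>x. c \<cdot> x) ` M" for d
    using c by (auto simp: image_image)
  moreover have "(\<lambda>x. d \<cdot> x) ` (\<lambda>x. c \<cdot> x) ` M = (\<lambda>x. (d * c) \<cdot> x) ` M" for d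
    by (auto simp: image_image)
  ultimately show ?thesis using c unfolding homothety_class_def
    by (auto; metis divide_eq_0_iff mult_eq_0_iff)
qed

lemma cls_eqD: "cls M = cls M' \<Longrightarrow> \<exists>c. c \<noteq> 0 \<and> M = (\<lambda>x. c \<cdot> x) ` M'"
  using cls_self[of M] by (auto simp: homothety_class_def)

lemma class_act_im: assumes "A \<in> GLV" shows "class_act (im A) (cls M) = cls (A ` M)"
proof -
  have e: "(\<lambda>x. c \<cdot> A x) ` (\<lambda>x. d \<cdot> x) ` M = (\<lambda>x. (c * d) \<cdot> x) ` A ` M" for c d
    by (auto simp: image_image GL_scale[OF assms])
  show ?thesis
  proof (rule Set.set_eqI, rule iffI)
    fix L assume "L \<in> class_act (im A) (cls M)"
    then obtain c d where "c \<noteq> 0" "d \<noteq> 0" "L = (\<lambda>x. c \<cdot> A x) ` (\<lambda>x. d \<cdot> x) ` M"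
      by (auto simp: class_act_def im_eq homothety_class_def)
    hence "L = (\<lambda>x. (c * d) \<cdot> x) ` A ` M" "c * d \<noteq> 0" by (simp_all only: e mult_eq_0_iff) simp
    thus "L \<in> cls (A ` M)" unfolding homothety_class_def by blast
  next
    fix L assume "L \<in> cls (A ` M)"
    then obtain c where c: "c \<noteq> 0" "L = (\<lambda>x. c \<cdot> x) ` A ` M" by (auto simp: homothety_class_def)
    hence "L = (\<lambda>x. c \<cdot> A x) ` M" "(\<lambda>x. c \<cdot> A x) \<in> im A"
      by (auto simp: image_image im_eq)
    thus "L \<in> class_act (im A) (cls M)" using cls_self unfolding class_act_def by blast
  qed
qed

lemma class_act_mult:
  assumes "g \<in> carrier G" "h \<in> carrier G"
  shows "class_act (g \<otimes>\<^bsub>G\<^esub> h) (cls M) = class_act g (class_act h (cls M))"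
proof -
  obtain A B where "A \<in> GLV" "g = im A" "B \<in> GLV" "h = im B" using assms by (auto simp: carrier_PGL)
  thus ?thesis by (simp add: im_mult class_act_im GL_comp image_comp)
qed

lemma class_act_one: "class_act \<one>\<^bsub>G\<^esub> (cls M) = cls M"
  by (simp add: im_id class_act_im GL_id)

lemma class_act_cls: "g \<in> carrier G \<Longrightarrow> \<exists>M'. class_act g (cls M) = cls M'"
  by (auto simp: carrier_PGL class_act_im)

lemma class_act_inv:
  assumes "g \<in> carrier G" "class_act g (cls M) = cls M'"
  shows "class_act (inv\<^bsub>G\<^esub> g) (cls M') = cls M"
  using assms class_act_mult[of "inv\<^bsub>G\<^esub> g" g M] group.inv_closed[OF group_PGL]
  by (simp add: group.l_inv[OF group_PGL] class_act_one)

subsection \<open>Standard lattices\<close>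

abbreviation "std \<equiv> std_lattice v smul b \<pi>"

lemma std_iff:
  assumes "I \<subseteq> {1..n}"
  shows "x \<in> std I k \<longleftrightarrow> (\<forall>i\<in>{1..n}. if i \<in> I then vge (k i) (crd x i) else crd x i = 0)"
proof
  assume "x \<in> std I k"
  then obtain c where "x = (\<Sum>i\<in>I. (\<pi> powi k i * c i) \<cdot> b i)" "\<forall>i\<in>I. vge 0 (c i)"
    by (auto simp: std_lattice_def val_ring_iff)
  thus "\<forall>i\<in>{1..n}. if i \<in> I then vge (k i) (crd x i) else crd x i = 0"
    using assms by (auto simp: crd_comb vge_mult_left simp del: crd_sum crd_scale)
next
  assume h: "\<forall>i\<in>{1..n}. if i \<in> I then vge (k i) (crd x i) else crd x i = 0"
  let ?c = "\<lambda>i. \<pi> powi (- k i) * crd x i"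
  have "x = (\<Sum>i\<in>I. (\<pi> powi k i * ?c i) \<cdot> b i)"
    by (rule vec_eqI) (use assms h in \<open>auto simp: crd_comb power_int_minus simp del: crd_sum crd_scale\<close>)
  moreover have "\<forall>i\<in>I. ?c i \<in> val_ring v"
    using h assms by (auto simp: val_ring_iff vge_mult_left)
  ultimately show "x \<in> std I k" unfolding std_lattice_def mem_Collect_eq
    by (intro exI[of _ ?c] conjI)
qed

lemma std_crd_zero: "x \<in> std I k \<Longrightarrow> I \<subseteq> {1..n} \<Longrightarrow> i \<in> {1..n} \<Longrightarrow> i \<notin> I \<Longrightarrow> crd x i = 0"
  using std_iff by metis

lemma std_cong: "(\<And>i. i \<in> I \<Longrightarrow> k i = l i) \<Longrightarrow> std I k = std I l"
  unfolding std_lattice_def by (metis (no_types, lifting) sum.cong)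

lemma std_scale:
  assumes "I \<subseteq> {1..n}" "c \<noteq> 0"
  shows "(\<lambda>x. c \<cdot> x) ` std I k = std I (\<lambda>i. k i + ord c)"
proof (rule Set.set_eqI, rule iffI)
  fix x assume "x \<in> (\<lambda>x. c \<cdot> x) ` std I k"
  thus "x \<in> std I (\<lambda>i. k i + ord c)" using assms by (auto simp: std_iff vge_mult_left split: if_splits)
next
  fix x assume "x \<in> std I (\<lambda>i. k i + ord c)"
  hence "inverse c \<cdot> x \<in> std I k" using assms
    by (auto simp: std_iff vge_mult_left ord_inverse split: if_splits)
  moreover have "x = c \<cdot> inverse c \<cdot> x" using assms by simp
  ultimately show "x \<in> (\<lambda>x. c \<cdot> x) ` std I k" by blast
qed

lemma std_basis_mem:
  assumes "I \<subseteq> {1..n}" "i \<in> I" shows "a \<cdot> b i \<in> std I k \<longleftrightarrow> vge (k i) a"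
proof -
  have "i \<in> {1..n}" using assms by blast
  thus ?thesis using assms by (auto simp: std_iff crd_b split: if_splits)
qed

text \<open>The generators \<open>\<pi> powi k i \<cdot> b i\<close> of one lattice, tested for
  membership in the other, give an inclusion of index sets and an inequality of exponents; the
  symmetric test turns both into equalities.\<close>

lemma std_eqD:
  assumes "std I k = std J l" "I \<subseteq> {1..n}" "J \<subseteq> {1..n}"
  shows "I = J" and "\<And>i. i \<in> I \<Longrightarrow> k i = l i"
proof -
  have sub: "I \<subseteq> J \<and> (\<forall>i\<in>I. l i \<le> k i)"
    if "std I k = std J l" "I \<subseteq> {1..n}" "J \<subseteq> {1..n}" for I J k l
  proof -
    have "i \<in> J \<and> l i \<le> k i" if i: "i \<in> I" for i
    proof -
      have i': "i \<in> {1..n}" using i \<open>I \<subseteq> {1..n}\<close> by blast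
      have "\<pi> powi k i \<cdot> b i \<in> std I k"
        using std_basis_mem[OF \<open>I \<subseteq> {1..n}\<close> i] by (simp add: vge_def)
      hence "\<pi> powi k i \<cdot> b i \<in> std J l" using \<open>std I k = std J l\<close> by simp
      thus ?thesis using i' \<open>J \<subseteq> {1..n}\<close> by (auto simp: std_iff crd_b vge_def split: if_splits)
    qed
    thus ?thesis by blast
  qed
  show IJ: "I = J" using sub[OF assms] sub[OF assms(1)[symmetric] assms(3,2)] by blast
  fix i assume "i \<in> I"
  thus "k i = l i" using sub[OF assms] sub[OF assms(1)[symmetric] assms(3,2)] IJ by force
qed

text \<open>The vertex belonging to \<open>std I k\<close>. The minus sign matches
  \<open>nu_diag\<close>: a diagonal matrix t raises the exponent \<open>k i\<close> by the
  valuation of \<open>t i\<close> and translates the coordinate by its negative.\<close>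

definition vx :: "nat set \<Rightarrow> (nat \<Rightarrow> int) \<Rightarrow> apt_point" where
  "vx I k = lam I (\<lambda>i. - real_of_int (k i))"

text \<open>The shift between two integral coordinate vectors is an integer d, read off at any
  element of I, and \<open>\<pi> powi d\<close> is the homothety that realizes it on
  lattices.\<close>

lemma vx_eqD:
  assumes "vx I k = vx J l" "J \<subseteq> {1..n}" "I \<noteq> {}"
  shows "I = J \<and> cls (std I k) = cls (std J l)"
proof -
  obtain c where IJ: "I = J" and c: "\<forall>i\<in>I. - real_of_int (l i) = - real_of_int (k i) + c"
    using assms(1) unfolding vx_def lam_eq_iff by blast
  obtain i0 where i0: "i0 \<in> I" using assms(3) by blast
  define d where "d = k i0 - l i0"
  have cd: "c = real_of_int d" using c i0 by (auto simp: d_def)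
  have "k i = l i + d" if "i \<in> I" for i
  proof -
    have "real_of_int (k i) = real_of_int (l i) + real_of_int d" using c that cd by auto
    thus ?thesis by linarith
  qed
  hence "std I k = (\<lambda>x. \<pi> powi d \<cdot> x) ` std I l"
    using assms(2) IJ by (subst std_scale) (auto intro!: std_cong)
  thus ?thesis using IJ by (simp add: cls_scale)
qed

text \<open>A homothety by c changes all exponents by the same amount \<open>ord c\<close>, which is
  invisible in the coordinates of a vertex.\<close>

lemma cls_std_eqD:
  assumes "cls (std I k) = cls (std J l)" "I \<subseteq> {1..n}" "J \<subseteq> {1..n}"
  shows "vx I k = vx J l"
proof -
  obtain c where c: "c \<noteq> 0" "std I k = (\<lambda>x. c \<cdot> x) ` std J l" using cls_eqD[OF assms(1)] by blast
  have e: "std I k = std J (\<lambda>i. l i + ord c)" using c assms std_scale by simp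
  have "I = J" "\<And>i. i \<in> I \<Longrightarrow> k i = l i + ord c"
    using std_eqD[OF e] assms by blast+
  thus ?thesis unfolding vx_def lam_eq_iff by (auto intro!: exI[of _ "real_of_int (ord c)"])
qed

subsection \<open>Transvections\<close>

definition tv :: "nat \<Rightarrow> nat \<Rightarrow> 'k \<Rightarrow> 'v \<Rightarrow> 'v" where
  "tv i j \<omega> x = x + (\<omega> * crd x j) \<cdot> b i"

lemma crd_tv:
  "i \<in> {1..n} \<Longrightarrow> m \<in> {1..n} \<Longrightarrow> crd (tv i j \<omega> x) m = crd x m + (if m = i then \<omega> * crd x j else 0)"
  by (simp add: tv_def crd_b)

lemma tv_cancel:
  assumes "i \<in> {1..n}" "j \<in> {1..n}" "i \<noteq> j" shows "tv i j (- \<omega>) (tv i j \<omega> x) = x"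
  by (rule vec_eqI) (use assms in \<open>simp add: crd_tv\<close>)

lemma tv_GL:
  assumes "i \<in> {1..n}" "j \<in> {1..n}" "i \<noteq> j" shows "tv i j \<omega> \<in> GLV"
  unfolding GL_iff
proof (intro conjI allI)
  show "bij (tv i j \<omega>)"
    by (rule bij_betw_byWitness[where f' = "tv i j (- \<omega>)"])
       (use tv_cancel[OF assms] tv_cancel[OF assms, of "- \<omega>"] in auto)
qed (auto simp: tv_def scale_right_distrib scale_left_distrib algebra_simps)

text \<open>\<open>adm J l i j \<omega>\<close> says that the transvection with parameter \<open>\<omega>\<close> lies in the root group
  of \<open>a\<^sub>i\<^sub>j\<close> at the vertex \<open>vx J l\<close>.\<close>

definition adm :: "nat set \<Rightarrow> (nat \<Rightarrow> int) \<Rightarrow> nat \<Rightarrow> nat \<Rightarrow> 'k \<Rightarrow> bool" where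
  "adm J l i j \<omega> \<longleftrightarrow> \<omega> = 0 \<or> j \<notin> J \<or> i \<in> J \<and> vge (l i - l j) \<omega>"

text \<open>For \<open>j \<notin> J\<close> the coordinate j vanishes on the lattice; otherwise
  \<open>l i - l j\<close> is the valuation that carries the bound \<open>l j\<close> to the bound
  \<open>l i\<close>. Surjectivity holds because the inverse has the parameter
  \<open>- \<omega>\<close>, which is equally admissible.\<close>

lemma tv_std:
  assumes "i \<in> {1..n}" "j \<in> {1..n}" "i \<noteq> j" "adm J l i j \<omega>" "J \<subseteq> {1..n}"
  shows "tv i j \<omega> ` std J l = std J l"
proof -
  have sub: "tv i j \<omega> x \<in> std J l" if "adm J l i j \<omega>" "x \<in> std J l" for \<omega> x
  proof -
    have x: "if m \<in> J then vge (l m) (crd x m) else crd x m = 0" if "m \<in> {1..n}" for m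
      using \<open>x \<in> std J l\<close> that assms(5) by (simp add: std_iff)
    have "if i \<in> J then vge (l i) (\<omega> * crd x j) else \<omega> * crd x j = 0"
      using that(1) x[OF assms(2)] vge_mult[of "l i - l j" \<omega> "l j" "crd x j"]
      by (auto simp: adm_def split: if_splits)
    hence "if m \<in> J then vge (l m) (crd (tv i j \<omega> x) m) else crd (tv i j \<omega> x) m = 0"
      if "m \<in> {1..n}" for m
      using x[OF that] that assms(1) by (auto simp: crd_tv intro: vge_add)
    thus ?thesis using assms(5) by (simp add: std_iff)
  qed
  have "adm J l i j (- \<omega>)" using assms(4) by (simp add: adm_def)
  show ?thesis
  proof
    show "tv i j \<omega> ` std J l \<subseteq> std J l" using sub assms(4) by blast
    show "std J l \<subseteq> tv i j \<omega> ` std J l"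
    proof
      fix x assume "x \<in> std J l"
      hence "tv i j (- \<omega>) x \<in> std J l" using sub \<open>adm J l i j (- \<omega>)\<close> by blast
      moreover have "x = tv i j \<omega> (tv i j (- \<omega>) x)"
        using tv_cancel[OF assms(1-3), of "- \<omega>"] by simp
      ultimately show "x \<in> tv i j \<omega> ` std J l" by blast
    qed
  qed
qed

text \<open>The monoid of products of admissible transvections, kept in the linear group, where the
  elimination takes place; \<open>TV_U_pt\<close> carries it over to the projective group.\<close>

inductive_set TV :: "nat set \<Rightarrow> (nat \<Rightarrow> int) \<Rightarrow> ('v \<Rightarrow> 'v) set" for J l where
  id: "id \<in> TV J l"
| step: "u \<in> TV J l \<Longrightarrow> i \<in> {1..n} \<Longrightarrow> j \<in> {1..n} \<Longrightarrow> i \<noteq> j \<Longrightarrow> adm J l i j \<omega> \<Longrightarrow> tv i j \<omega> \<circ> u \<in> TV J l"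

lemma TV_GL: "u \<in> TV J l \<Longrightarrow> u \<in> GLV"
  by (induction rule: TV.induct) (blast intro: GL_id GL_comp tv_GL)+

lemma TV_std: assumes "J \<subseteq> {1..n}" shows "u \<in> TV J l \<Longrightarrow> u ` std J l = std J l"
proof (induction rule: TV.induct)
  case (step u i j \<omega>)
  have "(tv i j \<omega> \<circ> u) ` std J l = tv i j \<omega> ` std J l"
    by (simp only: image_comp[symmetric] step.IH)
  thus ?case using tv_std step assms by simp
qed simp

lemma TV_comp: "u \<in> TV J l \<Longrightarrow> w \<in> TV J l \<Longrightarrow> u \<circ> w \<in> TV J l"
  by (induction rule: TV.induct) (auto simp: comp_assoc intro: TV.step)

lemma TV_mono:
  assumes "\<And>i j \<omega>. adm J l i j \<omega> \<Longrightarrow> adm J' l' i j \<omega>"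
  shows "u \<in> TV J l \<Longrightarrow> u \<in> TV J' l'"
  by (induction rule: TV.induct) (blast intro: TV.intros assms)+

text \<open>All factors read coordinate r and none changes it, so the composite adds all the
  multiples of the original coordinate at once.\<close>

lemma col_TV:
  assumes "finite F" "F \<subseteq> {1..n}" "r \<in> {1..n} - F" "\<And>i. i \<in> F \<Longrightarrow> adm J l i r (c i)"
  shows "(\<lambda>x. x + (\<Sum>i\<in>F. (c i * crd x r) \<cdot> b i)) \<in> TV J l"
  using assms
proof (induction F)
  case empty
  thus ?case using TV.id[of J l] by (simp add: id_def)
next
  case (insert i F)
  let ?u = "\<lambda>x. x + (\<Sum>i\<in>F. (c i * crd x r) \<cdot> b i)"
  have r: "crd (?u x) r = crd x r" for x
    using insert.prems by (simp add: crd_comb del: crd_sum)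
  have "(\<lambda>x. x + (\<Sum>i\<in>insert i F. (c i * crd x r) \<cdot> b i)) = tv i r (c i) \<circ> ?u"
    using insert.hyps r by (auto simp: fun_eq_iff tv_def algebra_simps simp del: crd_add crd_sum)
  moreover have "tv i r (c i) \<circ> ?u \<in> TV J l" using insert by (intro TV.step) auto
  ultimately show ?case by simp
qed

text \<open>One elimination step with pivot row r. The third property protects columns that have no
  entry in row r, among them those cleared before. The fourth keeps a module inside its coordinate
  subspace: rows in which y vanishes are left alone for every x.\<close>

lemma clear_column:
  assumes r: "r \<in> {1..n}" "crd y r \<noteq> 0"
    and adm: "\<And>i. i \<in> {1..n} - {r} \<Longrightarrow> adm J l i r (- (crd y i / crd y r))"
  obtains u where "u \<in> TV J l" "u y = crd y r \<cdot> b r" "\<And>x. crd x r = 0 \<Longrightarrow> u x = x"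
    "\<And>x i. i \<in> {1..n} \<Longrightarrow> i \<noteq> r \<Longrightarrow> crd y i = 0 \<Longrightarrow> crd (u x) i = crd x i"
proof -
  define u where "u x = x + (\<Sum>i\<in>{1..n} - {r}. (- (crd y i / crd y r) * crd x r) \<cdot> b i)" for x
  have crd_u: "crd (u x) i = crd x i + (if i = r then 0 else - (crd y i / crd y r) * crd x r)"
    if "i \<in> {1..n}" for x i
  proof -
    have "crd (\<Sum>i\<in>{1..n} - {r}. (- (crd y i / crd y r) * crd x r) \<cdot> b i) i
        = (if i \<in> {1..n} - {r} then - (crd y i / crd y r) * crd x r else 0)"
      using that by (intro crd_comb) auto
    thus ?thesis using that unfolding u_def crd_add by simp
  qed
  show ?thesis
  proof
    show "u \<in> TV J l" unfolding u_def using r adm by (intro col_TV) auto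
    show "u y = crd y r \<cdot> b r"
      by (rule vec_eqI) (use r in \<open>simp add: crd_u crd_b\<close>)
    show "u x = x" if "crd x r = 0" for x using that by (simp add: u_def)
    show "crd (u x) i = crd x i" if "i \<in> {1..n}" "i \<noteq> r" "crd y i = 0" for x i
      using that by (simp add: crd_u)
  qed
qed

subsection \<open>Reduction of lattices to standard form\<close>

text \<open>Submodules over the valuation ring, without finite generation: in the induction of
  \<open>exists_TV_std\<close>, containment in a standard lattice takes its place and passes at once
  to the smaller module \<open>M2\<close>.\<close>

definition val_submodule :: "'v set \<Rightarrow> bool" where
  "val_submodule M \<longleftrightarrow> 0 \<in> M \<and> (\<forall>x\<in>M. \<forall>y\<in>M. x + y \<in> M) \<and> (\<forall>c x. vge 0 c \<longrightarrow> x \<in> M \<longrightarrow> c \<cdot> x \<in> M)"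

lemma val_submodule_add: "val_submodule M \<Longrightarrow> x \<in> M \<Longrightarrow> y \<in> M \<Longrightarrow> x + y \<in> M"
  and val_submodule_scale: "val_submodule M \<Longrightarrow> vge 0 c \<Longrightarrow> x \<in> M \<Longrightarrow> c \<cdot> x \<in> M"
  by (auto simp: val_submodule_def)

lemma val_submodule_image:
  assumes "A \<in> GLV" "val_submodule M" shows "val_submodule (A ` M)"
  unfolding val_submodule_def
proof (intro conjI ballI allI impI)
  show "0 \<in> A ` M" using assms GL_zero[OF assms(1)] by (auto simp: val_submodule_def image_iff intro!: bexI[of _ 0])
next
  fix x y assume "x \<in> A ` M" "y \<in> A ` M"
  thus "x + y \<in> A ` M" using assms(2) by (auto simp: val_submodule_def GL_add[OF assms(1), symmetric])
next
  fix c x assume "vge 0 c" "x \<in> A ` M"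
  thus "c \<cdot> x \<in> A ` M" using assms(2) by (auto simp: val_submodule_def GL_scale[OF assms(1), symmetric])
qed

text \<open>The valuations of the coordinates of M are bounded below. A vector attaining the minimum
  splits off a summand, because clearing its other coordinates takes integral transvections only.\<close>

lemma exists_TV_std:
  assumes "F \<subseteq> {1..n}" "val_submodule M" "M \<subseteq> std F (\<lambda>_. m)"
  shows "\<exists>u\<in>TV {1..n} (\<lambda>_. 0). \<exists>I k. I \<subseteq> F \<and> u ` M = std I k \<and>
    (\<forall>x. (\<forall>i\<in>F. crd x i = 0) \<longrightarrow> u x = x)"
  using assms
proof (induction "card F" arbitrary: F M m rule: less_induct)
  case less
  note F = less.prems(1) and M = less.prems(2) and Mm = less.prems(3)
  have crdM: "if i \<in> F then vge m (crd x i) else crd x i = 0" if "x \<in> M" "i \<in> {1..n}" for x i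
    using Mm that F by (auto simp: std_iff subset_iff)
  show ?case
  proof (cases "M = {0}")
    case True
    have "std {} k = {0}" for k by (auto simp: std_lattice_def)
    hence "{} \<subseteq> F \<and> id ` M = std {} (\<lambda>_. 0) \<and> (\<forall>x. (\<forall>i\<in>F. crd x i = 0) \<longrightarrow> id x = x)"
      using True by simp
    thus ?thesis using TV.id by blast
  next
    case False
    let ?Q = "\<lambda>(x, i). x \<in> M \<and> i \<in> F \<and> crd x i \<noteq> 0"
    obtain x0 where "x0 \<in> M" "x0 \<noteq> 0" using False M by (auto simp: val_submodule_def)
    then obtain i0 where "i0 \<in> {1..n}" "crd x0 i0 \<noteq> 0" using vec_eqI[of x0 0] by auto
    hence "?Q (x0, i0)" using crdM[of x0 i0] \<open>x0 \<in> M\<close> by (auto split: if_splits)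
    \<comment> \<open>The valuations of the coordinates are bounded below by m because M lies in
      \<open>std F (\<lambda>_. m)\<close>. After subtracting m they are natural numbers, so a least
      one is attained.\<close>
    then obtain q where q: "?Q q"
      "\<And>q'. ?Q q' \<Longrightarrow> nat (ord (crd (fst q) (snd q)) - m) \<le> nat (ord (crd (fst q') (snd q')) - m)"
      using ex_has_least_nat[of ?Q _ "\<lambda>q. nat (ord (crd (fst q) (snd q)) - m)"] by blast
    obtain y r where qyr: "q = (y, r)" by (cases q)
    have y: "y \<in> M" "r \<in> F" "crd y r \<noteq> 0" using q(1) qyr by auto
    have r: "r \<in> {1..n}" using y F by blast
    define d where "d = ord (crd y r)"
    have min: "vge d (crd x i)" if "x \<in> M" "i \<in> F" for x i
    proof (cases "crd x i = 0")
      case False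
      have "nat (d - m) \<le> nat (ord (crd x i) - m)"
        using q(2)[of "(x, i)"] that False qyr by (simp add: d_def)
      moreover have "m \<le> ord (crd x i)" using crdM[of x i] that False F by (auto simp: vge_def)
      moreover have "m \<le> d" using crdM[OF y(1) r] y by (simp add: vge_def d_def)
      ultimately have "d \<le> ord (crd x i)" by linarith
      thus ?thesis by (simp add: vge_def)
    qed simp
    have adm: "adm {1..n} (\<lambda>_. 0) i r (- (crd y i / crd y r))" if i: "i \<in> {1..n} - {r}" for i
    proof (cases "crd y i = 0")
      case False
      hence "i \<in> F" using crdM[of y i] y i by (auto split: if_splits)
      hence "vge 0 (crd y i / crd y r)"
        using min[of y i] y False by (simp add: vge_def ord_divide d_def)
      thus ?thesis using i by (simp add: adm_def)
    qed (simp add: adm_def)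
    obtain u1 where u1: "u1 \<in> TV {1..n} (\<lambda>_. 0)" "u1 y = crd y r \<cdot> b r"
      "\<And>x. crd x r = 0 \<Longrightarrow> u1 x = x"
      "\<And>x i. i \<in> {1..n} \<Longrightarrow> i \<noteq> r \<Longrightarrow> crd y i = 0 \<Longrightarrow> crd (u1 x) i = crd x i"
      using clear_column[OF r y(3) adm] by blast
    define M1 where "M1 = u1 ` M"
    have subM1: "val_submodule M1" unfolding M1_def using val_submodule_image TV_GL u1(1) M by blast
    have M1d: "M1 \<subseteq> std F (\<lambda>_. d)"
    proof
      fix z assume "z \<in> M1"
      then obtain x where x: "x \<in> M" "z = u1 x" by (auto simp: M1_def)
      have "vge d (crd x i)" if "i \<in> {1..n}" for i
        using crdM[OF x(1) that] min[OF x(1), of i] by (cases "i \<in> F") auto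
      hence "x \<in> std {1..n} (\<lambda>_. d)" by (simp add: std_iff)
      \<comment> \<open>Only differences of exponents enter \<open>adm\<close>, so transvections
        that are integral preserve the constant lattice for every d.\<close>
      moreover have "u1 ` std {1..n} (\<lambda>_. d) = std {1..n} (\<lambda>_. d)"
        using u1(1) by (intro TV_std TV_mono[of "{1..n}" "\<lambda>_. 0" "{1..n}" "\<lambda>_. d"]) (auto simp: adm_def)
      ultimately have "z \<in> std {1..n} (\<lambda>_. d)" using x by blast
      moreover have "crd z i = 0" if "i \<in> {1..n}" "i \<notin> F" for i
      proof -
        have "i \<noteq> r" "crd y i = 0" "crd x i = 0"
          using that y crdM[OF y(1) that(1)] crdM[OF x(1) that(1)] by (auto split: if_splits)
        thus ?thesis using u1(4)[OF that(1)] x by simp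
      qed
      ultimately show "z \<in> std F (\<lambda>_. d)" using F by (simp add: std_iff)
    qed
    have br: "a \<cdot> b r \<in> M1" if "vge d a" for a
    proof -
      have "vge 0 (a / crd y r)" using that y(3) by (auto simp: vge_def ord_divide d_def)
      moreover have "crd y r \<cdot> b r \<in> M1" using u1(2) y(1) unfolding M1_def by (metis imageI)
      ultimately have "(a / crd y r) \<cdot> (crd y r \<cdot> b r) \<in> M1"
        by (rule val_submodule_scale[OF subM1])
      thus ?thesis using y(3) by simp
    qed
    define M2 where "M2 = {x \<in> M1. crd x r = 0}"
    have "val_submodule M2" using subM1 by (auto simp: val_submodule_def M2_def)
    moreover have "M2 \<subseteq> std (F - {r}) (\<lambda>_. d)"
    proof
      fix x assume "x \<in> M2"
      hence "x \<in> std F (\<lambda>_. d)" "crd x r = 0" using M1d by (auto simp: M2_def)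
      moreover have "F - {r} \<subseteq> {1..n}" using F by blast
      ultimately show "x \<in> std (F - {r}) (\<lambda>_. d)" using F by (auto simp: std_iff)
    qed
    moreover have "card (F - {r}) < card F"
      using y(2) F by (intro psubset_card_mono) (auto intro: finite_subset)
    moreover have "F - {r} \<subseteq> {1..n}" using F by blast
    ultimately obtain u2 I2 k2 where u2: "u2 \<in> TV {1..n} (\<lambda>_. 0)" "I2 \<subseteq> F - {r}"
      "u2 ` M2 = std I2 k2" "\<And>x. (\<forall>i\<in>F - {r}. crd x i = 0) \<Longrightarrow> u2 x = x"
      using less.hyps[of "F - {r}" M2 d] by blast
    have GL2: "u2 \<in> GLV" using u2(1) TV_GL by blast
    \<comment> \<open>Multiples of \<open>b r\<close> have no coordinates in \<open>F - {r}\<close>.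
      This is the purpose of the last clause of the induction: u2 must not disturb the summand
      already split off.\<close>
    have u2br: "u2 (a \<cdot> b r) = a \<cdot> b r" for a
    proof (rule u2(4), rule ballI)
      fix i assume "i \<in> F - {r}"
      moreover from this have "i \<in> {1..n}" using F by blast
      ultimately show "crd (a \<cdot> b r) i = 0" using r by (simp add: crd_b)
    qed
    define I k where "I = insert r I2" and "k = k2(r := d)"
    have I: "I \<subseteq> {1..n}" "I2 \<subseteq> {1..n}" "r \<notin> I2" using u2(2) r F by (auto simp: I_def)
    \<comment> \<open>\<open>std I k\<close> is the direct sum of the multiples of
      \<open>b r\<close> with coefficient of valuation at least d and of \<open>std I2 k2\<close>.
      The same splitting holds for \<open>M1\<close>, with \<open>M2\<close> as the second
      summand.\<close>
    have split: "z \<in> std I k \<longleftrightarrow> vge d (crd z r) \<and> z - crd z r \<cdot> b r \<in> std I2 k2" for z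
    proof -
      have "(if i \<in> I then vge (k i) (crd z i) else crd z i = 0) \<longleftrightarrow>
          (if i = r then vge d (crd z r) else if i \<in> I2 then vge (k2 i) (crd z i) else crd z i = 0)"
        if "i \<in> {1..n}" for i by (auto simp: I_def k_def)
      moreover have "(if i \<in> I2 then vge (k2 i) (crd (z - crd z r \<cdot> b r) i) else crd (z - crd z r \<cdot> b r) i = 0)
          \<longleftrightarrow> (i \<noteq> r \<longrightarrow> (if i \<in> I2 then vge (k2 i) (crd z i) else crd z i = 0))"
        if "i \<in> {1..n}" for i using that r I(3) by (auto simp: crd_b)
      ultimately show ?thesis unfolding std_iff[OF I(1)] std_iff[OF I(2)] using r by auto
    qed
    have "u2 ` M1 = std I k"
    proof (rule Set.set_eqI, rule iffI)
      fix z assume "z \<in> u2 ` M1"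
      then obtain x where x: "x \<in> M1" "z = u2 x" by blast
      define a where "a = crd x r"
      have a: "vge d a" using M1d x(1) y(2) F r by (auto simp: a_def std_iff subset_iff)
      have "x + (- a) \<cdot> b r \<in> M1" using a by (intro val_submodule_add subM1 x(1) br) simp
      hence "x - a \<cdot> b r \<in> M2" using r by (simp add: M2_def a_def crd_b)
      hence x': "u2 (x - a \<cdot> b r) \<in> std I2 k2" using u2(3) by blast
      hence "crd (u2 (x - a \<cdot> b r)) r = 0" using I r by (auto simp: std_iff)
      moreover have zx: "u2 (x - a \<cdot> b r) = z - a \<cdot> b r" using x(2) by (simp add: GL_diff[OF GL2] u2br)
      ultimately have "crd z r = a" using r by (simp add: crd_b)
      thus "z \<in> std I k" using split a x' zx by simp
    next
      fix z assume "z \<in> std I k"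
      hence z: "vge d (crd z r)" "z - crd z r \<cdot> b r \<in> std I2 k2" using split by auto
      then obtain x where x: "x \<in> M2" "z - crd z r \<cdot> b r = u2 x" using u2(3) by blast
      have "z = u2 x + crd z r \<cdot> b r" using x(2) by (metis diff_add_cancel)
      hence "z = u2 (x + crd z r \<cdot> b r)" by (simp add: GL_add[OF GL2] u2br)
      moreover have "x + crd z r \<cdot> b r \<in> M1"
        using x(1) by (intro val_submodule_add subM1 br z(1)) (simp add: M2_def)
      ultimately show "z \<in> u2 ` M1" by blast
    qed
    hence "(u2 \<circ> u1) ` M = std I k" by (simp add: M1_def image_comp)
    moreover have "I \<subseteq> F" using u2(2) y(2) by (auto simp: I_def)
    moreover have "\<forall>x. (\<forall>i\<in>F. crd x i = 0) \<longrightarrow> (u2 \<circ> u1) x = x"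
      using u1(3) u2(4) y(2) by simp
    moreover have "u2 \<circ> u1 \<in> TV {1..n} (\<lambda>_. 0)" using TV_comp u1(1) u2(1) by blast
    ultimately show ?thesis by blast
  qed
qed

subsection \<open>Elimination between standard lattices\<close>

text \<open>The state of the elimination after the columns in P. The entries t are indexed by rows,
  as in \<open>monomial\<close>, so that \<open>P = {1..n}\<close> yields a monomial matrix.\<close>

definition monomial_cols ::
  "nat set \<Rightarrow> nat set \<Rightarrow> nat set \<Rightarrow> (nat \<Rightarrow> nat) \<Rightarrow> (nat \<Rightarrow> 'k) \<Rightarrow> ('v \<Rightarrow> 'v) \<Rightarrow> bool" where
  "monomial_cols I J P w t B \<longleftrightarrow> inj_on w P \<and> w ` P \<subseteq> {1..n} \<and> w ` (P \<inter> I) \<subseteq> J \<and>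
     (\<forall>p\<in>P. t (w p) \<noteq> 0 \<and> B (b p) = t (w p) \<cdot> b (w p))"

lemma monomial_cols_pivot:
  assumes B: "B \<in> GLV" "B ` std I k = std J l" and IJ: "I \<subseteq> {1..n}" "J \<subseteq> {1..n}"
    and P: "P \<subseteq> {1..n}" "j \<in> {1..n}" "j \<notin> P" "P \<subseteq> I \<and> j \<in> I \<or> I \<subseteq> P \<and> j \<notin> I"
    and mc: "monomial_cols I J P w t B"
  shows "\<exists>r\<in>{1..n} - w ` P. crd (B (b j)) r \<noteq> 0 \<and>
    (\<forall>i\<in>{1..n} - {r}. adm J l i r (- (crd (B (b j)) i / crd (B (b j)) r))) \<and> (j \<in> I \<longrightarrow> r \<in> J)"
proof -
  let ?y = "B (b j)"
  have w: "inj_on w P" "w ` P \<subseteq> {1..n}" "w ` (P \<inter> I) \<subseteq> J"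
    "\<And>p. p \<in> P \<Longrightarrow> t (w p) \<noteq> 0" "\<And>p. p \<in> P \<Longrightarrow> B (b p) = t (w p) \<cdot> b (w p)"
    using mc by (auto simp: monomial_cols_def)
  have finP: "finite P" using P(1) finite_subset by blast
  define z where "z = b j - (\<Sum>p\<in>P. (crd ?y (w p) / t (w p)) \<cdot> b p)"
  have zj: "crd z j = 1"
    using P by (simp add: z_def crd_b crd_comb del: crd_sum)
  have "B z = ?y - (\<Sum>p\<in>P. crd ?y (w p) \<cdot> b (w p))"
    unfolding z_def GL_diff[OF B(1)] GL_sum[OF B(1)]
    by (intro arg_cong2[of _ _ _ _ "(-)"] refl sum.cong) (simp_all add: GL_scale[OF B(1)] w(4,5))
  also have "(\<Sum>p\<in>P. crd ?y (w p) \<cdot> b (w p)) = (\<Sum>i\<in>w ` P. crd ?y i \<cdot> b i)"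
    by (simp add: sum.reindex[OF w(1)])
  finally have crdBz: "crd (B z) i = (if i \<in> w ` P then 0 else crd ?y i)" if "i \<in> {1..n}" for i
    using that w(2) by (simp add: crd_comb del: crd_sum)
  show ?thesis
  proof (cases "j \<in> I")
    case True
    hence PI: "P \<subseteq> I" using P(4) by blast
    have "\<pi> powi k j \<cdot> b j \<in> std I k" using std_basis_mem[OF IJ(1) True] by (simp add: vge_def)
    hence "B (\<pi> powi k j \<cdot> b j) \<in> std J l" using B(2) by blast
    hence ystd: "\<pi> powi k j \<cdot> ?y \<in> std J l" by (simp add: GL_scale[OF B(1)])
    have y: "if i \<in> J then vge (l i - k j) (crd ?y i) else crd ?y i = 0" if "i \<in> {1..n}" for i
      using bspec[OF ystd[unfolded std_iff[OF IJ(2)]] that]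
      by (auto simp: vge_mult_left split: if_splits)
    have "\<exists>r\<in>J - w ` P. \<not> vge (l r - k j + 1) (crd ?y r)"
    proof (rule ccontr)
      assume "\<not> ?thesis"
      hence h: "vge (l r - k j + 1) (crd ?y r)" if "r \<in> J" "r \<notin> w ` P" for r using that by blast
      have "if i \<in> J then vge (l i - (k j - 1)) (crd (B z) i) else crd (B z) i = 0"
        if "i \<in> {1..n}" for i
        using crdBz[OF that] h[of i] y[OF that] by (auto simp: algebra_simps)
      hence "\<pi> powi (k j - 1) \<cdot> B z \<in> std J l"
        using IJ(2) by (simp add: std_iff vge_mult_left)
      hence "B (\<pi> powi (k j - 1) \<cdot> z) \<in> B ` std I k" using B(2) GL_scale[OF B(1)] by simp
      hence "\<pi> powi (k j - 1) \<cdot> z \<in> std I k"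
        by (simp only: inj_image_mem_iff[OF bij_is_inj[OF GL_bij[OF B(1)]]])
      hence "if j \<in> I then vge (k j) (crd (\<pi> powi (k j - 1) \<cdot> z) j) else crd (\<pi> powi (k j - 1) \<cdot> z) j = 0"
        unfolding std_iff[OF IJ(1)] using P(2) by (rule bspec)
      hence "vge (k j) (\<pi> powi (k j - 1) * crd z j)" using True by simp
      thus False using zj by (simp add: vge_def)
    qed
    then obtain r where r: "r \<in> J" "r \<notin> w ` P" "\<not> vge (l r - k j + 1) (crd ?y r)" by blast
    have rn: "r \<in> {1..n}" using r IJ by blast
    have r0: "crd ?y r \<noteq> 0" "ord (crd ?y r) = l r - k j"
      using r y[OF rn] by (auto simp: vge_def)
    \<comment> \<open>In the quotient \<open>k j\<close> cancels, which leaves the bound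
      \<open>l i - l r\<close>.\<close>
    have "adm J l i r (- (crd ?y i / crd ?y r))" if "i \<in> {1..n}" for i
    proof (cases "crd ?y i = 0")
      case False
      thus ?thesis using y[OF that] r0 by (auto simp: adm_def vge_def ord_divide split: if_splits)
    qed (simp add: adm_def)
    thus ?thesis using r r0 rn by blast
  next
    case False
    hence IP: "I \<subseteq> P" using P(4) by blast
    \<comment> \<open>Elements of \<open>std I k\<close> involve only columns in I, all cleared by
      now, so their images are supported on used rows. These images include a non-zero multiple of
      \<open>b i\<close> for each i in J.\<close>
    have "J \<subseteq> w ` P"
    proof
      fix i assume i: "i \<in> J"
      hence i': "i \<in> {1..n}" using IJ by blast
      have "\<pi> powi l i \<cdot> b i \<in> B ` std I k"
        using std_basis_mem[OF IJ(2) i] B(2) by (simp add: vge_def)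
      then obtain x where x: "x \<in> std I k" "B x = \<pi> powi l i \<cdot> b i" by (metis imageE)
      have "crd x p = 0" if "p \<in> {1..n} - P" for p
        using std_crd_zero[OF x(1) IJ(1)] that IP by blast
      hence x0: "\<forall>p\<in>{1..n} - P. crd x p \<cdot> B (b p) = 0" by simp
      have "B x = (\<Sum>p\<in>{1..n}. crd x p \<cdot> B (b p))" by (rule GL_expand[OF B(1)])
      also have "\<dots> = (\<Sum>p\<in>P. crd x p \<cdot> B (b p))"
        using P(1) x0 by (intro sum.mono_neutral_right) auto
      also have "\<dots> = (\<Sum>p\<in>P. (crd x p * t (w p)) \<cdot> b (w p))"
        by (intro sum.cong) (simp_all add: w(5))
      finally have "crd (B x) i = (\<Sum>p\<in>P. crd x p * t (w p) * crd (b (w p)) i)" by simp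
      moreover have "crd (B x) i \<noteq> 0" using x(2) i' by (simp add: crd_b)
      ultimately have "(\<Sum>p\<in>P. crd x p * t (w p) * crd (b (w p)) i) \<noteq> 0" by simp
      then obtain p where "p \<in> P" "crd x p * t (w p) * crd (b (w p)) i \<noteq> 0"
        by (rule sum.not_neutral_contains_not_neutral)
      hence "p \<in> P" "crd (b (w p)) i \<noteq> 0" by auto
      thus "i \<in> w ` P" using crd_b[OF i', of "w p"] w(2) by (auto split: if_splits)
    qed
    moreover have "\<exists>r\<in>{1..n} - w ` P. crd ?y r \<noteq> 0"
    proof (rule ccontr)
      assume "\<not> ?thesis"
      hence "B z = 0" by (intro vec_eqI) (auto simp: crdBz)
      hence "z = 0" using GL_inj[OF B(1), of z 0] GL_zero[OF B(1)] by simp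
      thus False using zj by simp
    qed
    ultimately show ?thesis using False by (auto simp: adm_def)
  qed
qed

lemma monomial_cols_step:
  assumes B: "B \<in> GLV" "B ` std I k = std J l" and IJ: "I \<subseteq> {1..n}" "J \<subseteq> {1..n}"
    and P: "P \<subseteq> {1..n}" "j \<in> {1..n}" "j \<notin> P" "P \<subseteq> I \<and> j \<in> I \<or> I \<subseteq> P \<and> j \<notin> I"
    and mc: "monomial_cols I J P w t B"
  shows "\<exists>u\<in>TV J l. \<exists>w t. monomial_cols I J (insert j P) w t (u \<circ> B)"
proof -
  let ?y = "B (b j)"
  obtain r where r: "r \<in> {1..n}" "r \<notin> w ` P" "crd ?y r \<noteq> 0" "j \<in> I \<longrightarrow> r \<in> J"
    "\<And>i. i \<in> {1..n} - {r} \<Longrightarrow> adm J l i r (- (crd ?y i / crd ?y r))"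
    using monomial_cols_pivot[OF assms] by blast
  obtain u where u: "u \<in> TV J l" "u ?y = crd ?y r \<cdot> b r" "\<And>x. crd x r = 0 \<Longrightarrow> u x = x"
    using clear_column[OF r(1,3,5)] by metis
  define w' t' where "w' = w(j := r)" and "t' = t(r := crd ?y r)"
  have w: "inj_on w P" "w ` P \<subseteq> {1..n}" "w ` (P \<inter> I) \<subseteq> J"
    "\<And>p. p \<in> P \<Longrightarrow> t (w p) \<noteq> 0" "\<And>p. p \<in> P \<Longrightarrow> B (b p) = t (w p) \<cdot> b (w p)"
    using mc by (auto simp: monomial_cols_def)
  have w': "w' p = w p" if "p \<in> P" for p using that P(3) by (auto simp: w'_def)
  have "t' (w' p) \<noteq> 0 \<and> (u \<circ> B) (b p) = t' (w' p) \<cdot> b (w' p)" if p: "p \<in> insert j P" for p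
  proof (cases "p = j")
    case True
    thus ?thesis using r(3) u(2) by (simp add: w'_def t'_def)
  next
    case False
    hence pP: "p \<in> P" and wp: "w p \<noteq> r" "w p \<in> {1..n}" using p r(2) w(2) by auto
    hence "u (t (w p) \<cdot> b (w p)) = t (w p) \<cdot> b (w p)"
      using r(1) by (intro u(3)) (simp add: crd_b)
    thus ?thesis using pP wp w w' by (simp add: t'_def)
  qed
  moreover have "inj_on w' (insert j P)"
  proof -
    have "inj_on w' P" using w(1) w' by (simp cong: inj_on_cong)
    moreover have "w' ` P = w ` P" using w' by auto
    ultimately show ?thesis using r(2) P(3) by (auto simp: w'_def)
  qed
  moreover have "w' ` insert j P \<subseteq> {1..n}" "w' ` (insert j P \<inter> I) \<subseteq> J"
    using w(2,3) r(1,4) P(3) by (auto simp: w'_def)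
  ultimately have "monomial_cols I J (insert j P) w' t' (u \<circ> B)"
    unfolding monomial_cols_def by blast
  thus ?thesis using u(1) by blast
qed

text \<open>Two inductions, over the columns in I and then over the others, because a column outside
  I gets its pivot only when all columns in I are cleared.\<close>

lemma exists_TV_monomial_cols:
  assumes A: "A \<in> GLV" "A ` std I k = std J l" and IJ: "I \<subseteq> {1..n}" "J \<subseteq> {1..n}"
  shows "\<exists>u\<in>TV J l. \<exists>w t. monomial_cols I J {1..n} w t (u \<circ> A)"
proof -
  have step: "\<exists>u\<in>TV J l. \<exists>w t. monomial_cols I J (insert j P) w t (u \<circ> A)"
    if h: "\<exists>u\<in>TV J l. \<exists>w t. monomial_cols I J P w t (u \<circ> A)" and P: "P \<subseteq> {1..n}" "j \<in> {1..n}" "j \<notin> P"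
      "P \<subseteq> I \<and> j \<in> I \<or> I \<subseteq> P \<and> j \<notin> I" for P j
  proof -
    obtain u w t where u: "u \<in> TV J l" "monomial_cols I J P w t (u \<circ> A)" using h by blast
    have "u \<circ> A \<in> GLV" using u(1) TV_GL A(1) GL_comp by blast
    moreover have "(u \<circ> A) ` std I k = std J l"
      by (simp only: image_comp[symmetric] A(2) TV_std[OF IJ(2) u(1)])
    ultimately obtain u' w' t' where u': "u' \<in> TV J l"
      "monomial_cols I J (insert j P) w' t' (u' \<circ> (u \<circ> A))"
      using monomial_cols_step[OF _ _ IJ P u(2)] by blast
    have "u' \<circ> u \<in> TV J l" using u'(1) u(1) TV_comp by blast
    thus ?thesis using u'(2) by (metis comp_assoc)
  qed
  have fin: "finite I" "finite ({1..n} - I)" using IJ finite_subset by auto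
  have one: "\<exists>u\<in>TV J l. \<exists>w t. monomial_cols I J P w t (u \<circ> A)" if "finite P" "P \<subseteq> I" for P
    using that
  proof (induction P)
    case empty
    have "monomial_cols I J {} w t B" for w t B by (simp add: monomial_cols_def)
    thus ?case using TV.id by blast
  next
    case (insert j P)
    have h: "P \<subseteq> {1..n}" "j \<in> {1..n}" "P \<subseteq> I \<and> j \<in> I \<or> I \<subseteq> P \<and> j \<notin> I"
      using insert.prems IJ(1) by auto
    show ?case using insert.prems by (intro step[OF insert.IH h(1,2) insert.hyps(2) h(3)]) blast
  qed
  have "\<exists>u\<in>TV J l. \<exists>w t. monomial_cols I J (I \<union> P) w t (u \<circ> A)"
    if "finite P" "P \<subseteq> {1..n} - I" for P
    using that
  proof (induction P)
    case empty
    show ?case using one[OF fin(1) subset_refl] by (simp only: Un_empty_right)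
  next
    case (insert j P)
    have h: "I \<union> P \<subseteq> {1..n}" "j \<in> {1..n}" "j \<notin> I \<union> P" "I \<union> P \<subseteq> I \<and> j \<in> I \<or> I \<subseteq> I \<union> P \<and> j \<notin> I"
      using insert IJ(1) by auto
    have "\<exists>u\<in>TV J l. \<exists>w t. monomial_cols I J (insert j (I \<union> P)) w t (u \<circ> A)"
      using insert.prems by (intro step[OF insert.IH h]) blast
    thus ?case by (simp only: Un_insert_right)
  qed
  from this[OF fin(2)] have "\<exists>u\<in>TV J l. \<exists>w t. monomial_cols I J (I \<union> ({1..n} - I)) w t (u \<circ> A)" by blast
  moreover have "I \<union> ({1..n} - I) = {1..n}" using IJ(1) by blast
  ultimately show ?thesis by simp
qed

lemma exists_TV_monomial:
  assumes A: "A \<in> GLV" "A ` std I k = std J l" and IJ: "I \<subseteq> {1..n}" "J \<subseteq> {1..n}"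
  obtains u w t where "u \<in> TV J l" "monomial smul b n t w (u \<circ> A)"
proof -
  obtain u w t where u: "u \<in> TV J l" and mc: "monomial_cols I J {1..n} w t (u \<circ> A)"
    using exists_TV_monomial_cols[OF assms] by blast
  \<comment> \<open>\<open>permutes\<close> demands the identity outside \<open>{1..n}\<close>,
    where the elimination leaves w undetermined.\<close>
  define w' where "w' i = (if i \<in> {1..n} then w i else i)" for i
  have "inj_on w {1..n}" using mc by (simp add: monomial_cols_def)
  moreover have "inj_on w' {1..n} = inj_on w {1..n}" by (rule inj_on_cong) (simp add: w'_def)
  ultimately have inj: "inj_on w' {1..n}" by simp
  have "w' ` {1..n} \<subseteq> {1..n}" using mc by (auto simp: monomial_cols_def w'_def)
  hence "bij_betw w' {1..n} {1..n}"
    using inj by (simp add: bij_betw_def endo_inj_surj)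
  hence perm: "w' permutes {1..n}" by (rule bij_imp_permutes) (auto simp: w'_def)
  have w': "(u \<circ> A) (b i) = t (w' i) \<cdot> b (w' i)" "t (w' i) \<noteq> 0" if "i \<in> {1..n}" for i
    using mc that by (auto simp: monomial_cols_def w'_def)
  have "t i \<noteq> 0" if "i \<in> {1..n}" for i
    using w'(2) permutes_image[OF perm] that by (metis imageE)
  moreover have "u \<circ> A \<in> GLV" using u TV_GL A(1) GL_comp by blast
  ultimately have "monomial smul b n t w' (u \<circ> A)"
    using perm w' unfolding monomial_def by blast
  thus ?thesis using that u by blast
qed

subsection \<open>Monomial matrices\<close>

lemma monomial_GL: "monomial smul b n t w A \<Longrightarrow> A \<in> GLV"
  and monomial_perm: "monomial smul b n t w A \<Longrightarrow> w permutes {1..n}"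
  and monomial_nonzero: "monomial smul b n t w A \<Longrightarrow> i \<in> {1..n} \<Longrightarrow> t i \<noteq> 0"
  and monomial_b: "monomial smul b n t w A \<Longrightarrow> i \<in> {1..n} \<Longrightarrow> A (b i) = t (w i) \<cdot> b (w i)"
  by (simp_all add: monomial_def)

lemma crd_monomial:
  assumes m: "monomial smul b n t w A" and "j \<in> {1..n}"
  shows "crd (A x) j = crd x (inv_into UNIV w j) * t j"
proof -
  note perm = monomial_perm[OF m]
  have "A x = (\<Sum>i\<in>{1..n}. crd x i \<cdot> A (b i))" by (rule GL_expand[OF monomial_GL[OF m]])
  also have "\<dots> = (\<Sum>i\<in>{1..n}. (crd x (inv_into UNIV w (w i)) * t (w i)) \<cdot> b (w i))"
    by (intro sum.cong refl) (simp add: monomial_b[OF m] permutes_inverses(2)[OF perm])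
  also have "\<dots> = (\<Sum>j\<in>{1..n}. (crd x (inv_into UNIV w j) * t j) \<cdot> b j)"
    by (rule sum.permute[OF perm, symmetric, unfolded comp_def])
  finally have "crd (A x) j = crd (\<Sum>j\<in>{1..n}. (crd x (inv_into UNIV w j) * t j) \<cdot> b j) j" by simp
  thus ?thesis using assms(2) by (simp add: crd_comb del: crd_sum)
qed

lemma monomial_std:
  assumes m: "monomial smul b n t w A" and I: "I \<subseteq> {1..n}"
  shows "A ` std I k = std (w ` I) (\<lambda>j. k (inv_into UNIV w j) + ord (t j))" (is "_ = std _ ?l")
proof -
  note perm = monomial_perm[OF m]
  have wI: "w ` I \<subseteq> {1..n}" using I permutes_image[OF perm] by blast
  have iff: "A x \<in> std (w ` I) ?l \<longleftrightarrow> x \<in> std I k" for x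
  proof -
    have 1: "(if w i \<in> w ` I then vge (?l (w i)) (crd (A x) (w i)) else crd (A x) (w i) = 0) \<longleftrightarrow>
        (if i \<in> I then vge (k i) (crd x i) else crd x i = 0)" if i: "i \<in> {1..n}" for i
    proof -
      have "w i \<in> {1..n}" using i permutes_in_image[OF perm] by blast
      hence "crd (A x) (w i) = crd x i * t (w i)" "t (w i) \<noteq> 0"
        using crd_monomial[OF m] monomial_nonzero[OF m] by (simp_all add: permutes_inverses(2)[OF perm])
      moreover have "w i \<in> w ` I \<longleftrightarrow> i \<in> I" by (rule inj_image_mem_iff[OF permutes_inj[OF perm]])
      ultimately show ?thesis
        by (auto simp: vge_mult_left mult.commute[of "crd x i"] permutes_inverses(2)[OF perm])
    qed
    have "A x \<in> std (w ` I) ?l \<longleftrightarrow>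
        (\<forall>j\<in>w ` {1..n}. if j \<in> w ` I then vge (?l j) (crd (A x) j) else crd (A x) j = 0)"
      unfolding std_iff[OF wI] permutes_image[OF perm] ..
    also have "\<dots> \<longleftrightarrow> (\<forall>i\<in>{1..n}. if i \<in> I then vge (k i) (crd x i) else crd x i = 0)"
      using 1 by simp
    finally show ?thesis unfolding std_iff[OF I] .
  qed
  show ?thesis
  proof (rule Set.set_eqI)
    fix z
    obtain x where "z = A x" using GL_bij[OF monomial_GL[OF m]] by (metis bij_pointE)
    thus "z \<in> A ` std I k \<longleftrightarrow> z \<in> std (w ` I) ?l"
      using iff inj_image_mem_iff[OF bij_is_inj[OF GL_bij[OF monomial_GL[OF m]]]] by simp
  qed
qed

text \<open>The index set and exponents are those of \<open>monomial_std\<close>: passing from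
  \<open>vx I k\<close> to \<open>std I k\<close> is compatible with monomial matrices.\<close>

lemma nu_diag_perm_vx:
  assumes m: "monomial smul b n t w A" and I: "I \<subseteq> {1..n}"
  shows "nu_diag v t (nu_perm w (vx I k)) = vx (w ` I) (\<lambda>j. k (inv_into UNIV w j) + ord (t j))"
proof -
  note perm = monomial_perm[OF m]
  obtain c where c: "\<And>i. i \<in> I \<Longrightarrow> coords (vx I k) i = - real_of_int (k i) + c"
    unfolding vx_def using coords_lam by blast
  let ?q = "nu_perm w (vx I k)"
  have q: "?q = lam (w ` I) (\<lambda>j. - real_of_int (k (inv_into UNIV w j)))"
    unfolding nu_perm_def lam_eq_iff
    by (auto simp: vx_def[of I k, THEN arg_cong[of _ _ fst]] permutes_inverses(2)[OF perm] c
        intro!: exI[of _ "-c"])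
  obtain d where d: "\<And>j. j \<in> w ` I \<Longrightarrow> coords ?q j = - real_of_int (k (inv_into UNIV w j)) + d"
    unfolding q using coords_lam by blast
  have t: "real_of_ereal (v (t j)) = real_of_int (ord (t j))" if "j \<in> w ` I" for j
  proof -
    have "j \<in> {1..n}" using that I permutes_image[OF perm] by blast
    thus ?thesis using monomial_nonzero[OF m] by (simp add: v_ord)
  qed
  have "fst ?q = w ` I" by (simp add: q)
  thus ?thesis unfolding nu_diag_def vx_def[of "w ` I"] lam_eq_iff
    by (auto simp: d t intro!: exI[of _ "-d"])
qed

abbreviation "N \<equiv> N_grp smul b n"
abbreviation "nuV \<equiv> nu v smul b n"

lemma N_carrier: "m \<in> N \<Longrightarrow> m \<in> carrier G"
  by (auto simp: N_grp_def intro: im_closed monomial_GL)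

text \<open>\<open>nu\<close> is well defined on vertices because any two monomial representatives
  of m send \<open>std I k\<close> to the same lattice class, and by \<open>cls_std_eqD\<close> this
  class determines the vertex.\<close>

lemma nu_vx:
  assumes "m \<in> N" "I \<noteq> {}" "I \<subseteq> {1..n}"
  obtains J l where "J \<noteq> {}" "J \<subseteq> {1..n}" "nuV m (vx I k) = vx J l"
    "class_act m (cls (std I k)) = cls (std J l)"
proof -
  obtain A t w where A: "m = im A" "monomial smul b n t w A" using assms(1) by (auto simp: N_grp_def)
  define l where "l t w = (\<lambda>j. k (inv_into UNIV w j) + ord (t j))" for t :: "nat \<Rightarrow> 'k" and w :: "nat \<Rightarrow> nat"
  have J: "w ` I \<subseteq> {1..n}" if "monomial smul b n t w A" for A t w
    using assms(3) permutes_image[OF monomial_perm[OF that]] by blast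
  have act: "class_act (im A) (cls (std I k)) = cls (std (w ` I) (l t w))"
    if "monomial smul b n t w A" for A t w
    using class_act_im[OF monomial_GL[OF that]] monomial_std[OF that assms(3)] by (simp add: l_def)
  have val: "nu_diag v t (nu_perm w (vx I k)) = vx (w ` I) (l t w)"
    if "monomial smul b n t w A" for A t w
    using nu_diag_perm_vx[OF that assms(3)] by (simp add: l_def)
  have "nuV m (vx I k) = vx (w ` I) (l t w)"
    unfolding nu_def
  proof (rule the_equality)
    show "\<exists>A t' w'. monomial smul b n t' w' A \<and> m = im A \<and> vx (w ` I) (l t w) = nu_diag v t' (nu_perm w' (vx I k))"
      using A val[OF A(2)] by metis
  next
    fix q assume "\<exists>A t w. monomial smul b n t w A \<and> m = im A \<and> q = nu_diag v t (nu_perm w (vx I k))"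
    then obtain A' t' w' where A': "monomial smul b n t' w' A'" "m = im A'"
      "q = nu_diag v t' (nu_perm w' (vx I k))" by blast
    have "cls (std (w' ` I) (l t' w')) = cls (std (w ` I) (l t w))"
      using act[OF A(2)] act[OF A'(1)] A(1) A'(2) by simp
    hence "vx (w' ` I) (l t' w') = vx (w ` I) (l t w)"
      using cls_std_eqD J A(2) A'(1) by blast
    thus "q = vx (w ` I) (l t w)" using A'(3) val[OF A'(1)] by simp
  qed
  moreover have "class_act m (cls (std I k)) = cls (std (w ` I) (l t w))"
    using act[OF A(2)] A(1) by simp
  ultimately show ?thesis using that[OF _ J[OF A(2)]] assms(2) by simp
qed

lemma nu_vx_eqI:
  assumes "m \<in> N" "I \<noteq> {}" "I \<subseteq> {1..n}" "J \<subseteq> {1..n}"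
    "class_act m (cls (std I k)) = cls (std J l)"
  shows "nuV m (vx I k) = vx J l"
  using nu_vx[OF assms(1-3), of k] cls_std_eqD assms(4,5) by metis

lemma monomial_id: "monomial smul b n (\<lambda>_. 1) id id"
  by (auto simp: monomial_def GL_id permutes_id)

lemma one_in_N: "\<one>\<^bsub>G\<^esub> \<in> N"
  unfolding im_id N_grp_def using monomial_id by blast

text \<open>Membership in \<open>Z_grp\<close> concerns all points of the open stratum, not only
  vertices, so the value is computed directly: a monomial representative of the identity is a scalar
  c, hence w is the identity and t is constant, and a common shift is trivial.\<close>

lemma nu_one_Lam:
  assumes "x \<in> Lam {1..n}" shows "nuV (im id) x = x"
proof -
  obtain y where y: "x = lam {1..n} y" using assms by (auto simp: Lam_def)
  have p: "nu_perm id x = x" using lam_coords[of "{1..n}" y] by (simp add: nu_perm_def y)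
  have val: "nu_diag v t (nu_perm w x) = x" if m: "monomial smul b n t w A" and A: "im id = im A" for A t w
  proof -
    obtain c where c: "c \<noteq> 0" "A = (\<lambda>x. c \<cdot> id x)" using im_eqD[OF A] by blast
    have i: "w i = i \<and> t i = c" if i: "i \<in> {1..n}" for i
    proof -
      have wi: "w i \<in> {1..n}" using permutes_in_image[OF monomial_perm[OF m]] i by blast
      have e: "c \<cdot> b i = t (w i) \<cdot> b (w i)" using monomial_b[OF m i] c by simp
      have "crd (c \<cdot> b i) i = c" using i by (simp add: crd_b)
      hence "t (w i) * crd (b (w i)) i = c" unfolding e by simp
      thus ?thesis using c(1) wi i by (auto simp: crd_b split: if_splits)
    qed
    have "w = id"
      using i permutes_not_in[OF monomial_perm[OF m]] by (metis eq_id_iff)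
    hence "nu_perm w x = x" using p by simp
    moreover have "nu_diag v t x = lam {1..n} (coords x)"
      unfolding nu_diag_def using i by (auto simp: y lam_eq_iff intro!: exI[of _ "real_of_ereal (v c)"])
    moreover have "lam {1..n} (coords x) = x" using lam_coords y by simp
    ultimately show ?thesis by simp
  qed
  show ?thesis unfolding nu_def
  proof (rule the_equality)
    show "\<exists>A t w. monomial smul b n t w A \<and> im id = im A \<and> x = nu_diag v t (nu_perm w x)"
      using monomial_id val[OF monomial_id refl] by metis
  qed (use val in blast)
qed

lemma N_inv: assumes "m \<in> N" shows "inv\<^bsub>G\<^esub> m \<in> N"
proof -
  obtain A t w where A: "m = im A" "monomial smul b n t w A" using assms by (auto simp: N_grp_def)
  note perm = monomial_perm[OF A(2)]
  let ?w = "inv_into UNIV w"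
  have "monomial smul b n (\<lambda>j. inverse (t (w j))) ?w (inv_into UNIV A)"
    unfolding monomial_def
  proof (intro conjI ballI)
    show "inv_into UNIV A \<in> GLV" using GL_inv monomial_GL A(2) by blast
    show "?w permutes {1..n}" by (rule permutes_inv[OF perm])
    fix i assume i: "i \<in> {1..n}"
    have wi: "w i \<in> {1..n}" using i permutes_in_image[OF perm] by blast
    show "inverse (t (w i)) \<noteq> 0" using monomial_nonzero[OF A(2) wi] by simp
    have w'i: "?w i \<in> {1..n}" using i permutes_in_image[OF permutes_inv[OF perm]] by blast
    have "A (inverse (t i) \<cdot> b (?w i)) = b i"
      using monomial_b[OF A(2) w'i] monomial_nonzero[OF A(2) i]
      by (simp add: GL_scale[OF monomial_GL[OF A(2)]] permutes_inverses(1)[OF perm])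
    hence "inv_into UNIV A (b i) = inverse (t i) \<cdot> b (?w i)"
      using bij_is_inj[OF GL_bij[OF monomial_GL[OF A(2)]]] by (metis inv_f_f)
    thus "inv_into UNIV A (b i) = inverse (t (w (?w i))) \<cdot> b (?w i)"
      by (simp add: permutes_inverses(1)[OF perm])
  qed
  moreover have "inv\<^bsub>G\<^esub> m = im (inv_into UNIV A)" using A(1) im_inv monomial_GL[OF A(2)] by simp
  ultimately show ?thesis unfolding N_grp_def by blast
qed

subsection \<open>Stabilizers of vertices\<close>

abbreviation "Upt \<equiv> U_pt v smul b n"
abbreviation "Ppt \<equiv> P_pt v smul b n"
abbreviation "U0 \<equiv> U0_hat v smul b n"

lemma unipotent_iff:
  assumes "i \<in> {1..n}" "j \<in> {1..n}" "i \<noteq> j"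
  shows "unipotent smul b n i j \<omega> A \<longleftrightarrow> A = tv i j \<omega>"
proof
  assume A: "unipotent smul b n i j \<omega> A"
  show "A = tv i j \<omega>"
  proof (rule GL_eqI)
    show "A \<in> GLV" using A by (simp add: unipotent_def)
    show "tv i j \<omega> \<in> GLV" using tv_GL assms by blast
    fix l assume "l \<in> {1..n}"
    thus "A (b l) = tv i j \<omega> (b l)"
      using A assms by (cases "l = j") (auto simp: unipotent_def tv_def crd_b)
  qed
next
  assume "A = tv i j \<omega>"
  thus "unipotent smul b n i j \<omega> A" using assms tv_GL by (auto simp: unipotent_def tv_def crd_b)
qed

lemma f_fun_le_iff:
  assumes "I \<noteq> {}" "I \<subseteq> {1..n}" "i \<in> {1..n}" "j \<in> {1..n}" "i \<noteq> j"
  shows "f_fun n (vx I k) i j \<le> v \<omega> \<longleftrightarrow> adm I k i j \<omega>"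
proof (cases "\<omega> = 0")
  case False
  thus ?thesis unfolding vx_def f_fun_lam[OF assms] adm_def by (auto simp: v_ord vge_def)
qed (simp add: adm_def)

lemma U_root_vx:
  assumes "I \<noteq> {}" "I \<subseteq> {1..n}" "i \<in> {1..n}" "j \<in> {1..n}" "i \<noteq> j"
  shows "U_root v smul b n i j (vx I k) = {im (tv i j \<omega>) | \<omega>. adm I k i j \<omega>}"
  unfolding U_root_def f_fun_le_iff[OF assms] unipotent_iff[OF assms(3-5)] by blast

lemma class_act_im_cls_std:
  assumes "A \<in> GLV" "A ` std I k = std I k" shows "class_act (im A) (cls (std I k)) = cls (std I k)"
  using assms by (simp add: class_act_im)

lemma U_root_union_vx:
  assumes "I \<noteq> {}" "I \<subseteq> {1..n}"
    and g: "g \<in> (\<Union>(i, j)\<in>{(i, j). i \<in> {1..n} \<and> j \<in> {1..n} \<and> i \<noteq> j}. U_root v smul b n i j (vx I k))"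
  shows "g \<in> carrier G \<and> class_act g (cls (std I k)) = cls (std I k)"
proof -
  obtain i j where ij: "i \<in> {1..n}" "j \<in> {1..n}" "i \<noteq> j" "g \<in> U_root v smul b n i j (vx I k)"
    using g by blast
  then obtain \<omega> where "g = im (tv i j \<omega>)" "adm I k i j \<omega>" using U_root_vx[OF assms(1,2)] by blast
  thus ?thesis
    using tv_GL[OF ij(1-3)] tv_std[OF ij(1-3) _ assms(2)] im_closed class_act_im_cls_std by simp
qed

lemma U_pt_subgroup: assumes "I \<noteq> {}" "I \<subseteq> {1..n}" shows "subgroup (Upt (vx I k)) G"
  unfolding U_pt_def
  by (rule group.generate_is_subgroup[OF group_PGL]) (use U_root_union_vx[OF assms] in blast)

lemma U_pt_stab:
  assumes I: "I \<noteq> {}" "I \<subseteq> {1..n}" and u: "u \<in> Upt (vx I k)"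
  shows "u \<in> carrier G" and "class_act u (cls (std I k)) = cls (std I k)"
proof -
  have "u \<in> carrier G \<and> class_act u (cls (std I k)) = cls (std I k)"
    using u unfolding U_pt_def
  proof (induction rule: generate.induct)
    case one
    show ?case using class_act_one monoid.one_closed[OF group.is_monoid[OF group_PGL]] by simp
  next
    case (incl g)
    thus ?case using U_root_union_vx[OF I] by blast
  next
    case (inv g)
    thus ?case using U_root_union_vx[OF I inv] class_act_inv group.inv_closed[OF group_PGL] by blast
  next
    case (eng g h)
    thus ?case using class_act_mult[of g h "std I k"] monoid.m_closed[OF group.is_monoid[OF group_PGL]] by auto
  qed
  thus "u \<in> carrier G" "class_act u (cls (std I k)) = cls (std I k)" by blast+
qed

lemma TV_U_pt:
  assumes "I \<noteq> {}" "I \<subseteq> {1..n}"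
  shows "u \<in> TV I k \<Longrightarrow> im u \<in> Upt (vx I k)"
proof (induction rule: TV.induct)
  case id
  show ?case using subgroup.one_closed[OF U_pt_subgroup[OF assms]] by (simp only: im_id)
next
  case (step u i j \<omega>)
  have "im (tv i j \<omega>) \<in> U_root v smul b n i j (vx I k)"
    using step.hyps U_root_vx[OF assms step.hyps(2-4)] by blast
  hence "im (tv i j \<omega>) \<in> Upt (vx I k)"
    unfolding U_pt_def using step.hyps(2-4) by (intro generate.incl) blast
  hence "im (tv i j \<omega>) \<otimes>\<^bsub>G\<^esub> im u \<in> Upt (vx I k)"
    using step.IH subgroup.m_closed[OF U_pt_subgroup[OF assms]] by blast
  thus ?case by (simp only: im_mult[OF tv_GL[OF step.hyps(2-4)] TV_GL[OF step.hyps(1)]])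
qed

lemma U_pt_subset_P_pt:
  assumes "I \<noteq> {}" "I \<subseteq> {1..n}" "u \<in> Upt (vx I k)" shows "u \<in> Ppt (vx I k)"
proof -
  have "nuV \<one>\<^bsub>G\<^esub> (vx I k) = vx I k"
    using one_in_N assms class_act_one by (intro nu_vx_eqI) auto
  hence "\<one>\<^bsub>G\<^esub> \<in> N_pt v smul b n (vx I k)" using one_in_N by (simp add: N_pt_def)
  moreover have "u = u \<otimes>\<^bsub>G\<^esub> \<one>\<^bsub>G\<^esub>"
    using U_pt_stab(1)[OF assms] monoid.r_one[OF group.is_monoid[OF group_PGL]] by simp
  ultimately show ?thesis using assms(3) unfolding P_pt_def set_mult_def by blast
qed

lemma P_pt_stab:
  assumes I: "I \<noteq> {}" "I \<subseteq> {1..n}" and h: "h \<in> Ppt (vx I k)"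
  shows "h \<in> carrier G" and "class_act h (cls (std I k)) = cls (std I k)"
proof -
  obtain u m where um: "u \<in> Upt (vx I k)" "m \<in> N" "nuV m (vx I k) = vx I k" "h = u \<otimes>\<^bsub>G\<^esub> m"
    using h unfolding P_pt_def set_mult_def N_pt_def by blast
  note u = U_pt_stab[OF I um(1)] and m = N_carrier[OF um(2)]
  show "h \<in> carrier G" using um(4) u(1) m monoid.m_closed[OF group.is_monoid[OF group_PGL]] by simp
  obtain J l where "J \<noteq> {}" "J \<subseteq> {1..n}" "nuV m (vx I k) = vx J l"
    "class_act m (cls (std I k)) = cls (std J l)"
    using nu_vx[OF um(2) I] by blast
  hence "class_act m (cls (std I k)) = cls (std I k)" using um(3) vx_eqD[of J l I k] I by simp
  thus "class_act h (cls (std I k)) = cls (std I k)" using class_act_mult[OF u(1) m] um(4) u(2) by simp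
qed

lemma vx_origin: "lam {1..n} (\<lambda>_. 0) = vx {1..n} (\<lambda>_. 0)"
  by (simp add: vx_def)

lemma full_index: "{1..n} \<noteq> {}" "{1..n} \<subseteq> {1..n}"
  using n_pos by auto

lemma U0_carrier: "g \<in> U0 \<Longrightarrow> g \<in> carrier G"
  using U_pt_stab(1)[OF full_index] im_closed monomial_GL monoid.m_closed[OF group.is_monoid[OF group_PGL]]
  by (auto simp: U0_hat_def set_mult_def vx_origin Z_grp_def T_grp_def)

lemma U_pt_U0: assumes "g \<in> Upt (vx {1..n} (\<lambda>_. 0))" shows "g \<in> U0"
proof -
  have "im id \<in> T_grp smul b n" unfolding T_grp_def using monomial_id by blast
  hence "\<one>\<^bsub>G\<^esub> \<in> Z_grp v smul b n" using nu_one_Lam unfolding im_id Z_grp_def by blast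
  moreover have "g = g \<otimes>\<^bsub>G\<^esub> \<one>\<^bsub>G\<^esub>"
    using U_pt_stab(1)[OF full_index assms] monoid.r_one[OF group.is_monoid[OF group_PGL]] by simp
  ultimately show ?thesis using assms unfolding U0_hat_def set_mult_def vx_origin by blast
qed

lemma one_in_U0: "\<one>\<^bsub>G\<^esub> \<in> U0"
  using subgroup.one_closed[OF U_pt_subgroup[OF full_index]] U_pt_U0 by blast

text \<open>The source of all decompositions. Elimination composes a representative of g with
  transvections at the target vertex until it is monomial; solving for g gives the two factors. For
  equal vertices this says that the stabilizer of a lattice class lies in
  \<open>P_pt\<close>.\<close>

lemma class_transport:
  assumes g: "g \<in> carrier G" and act: "class_act g (cls (std J l)) = cls (std I k)"
    and I: "I \<noteq> {}" "I \<subseteq> {1..n}" and J: "J \<noteq> {}" "J \<subseteq> {1..n}"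
  obtains u m where "u \<in> Upt (vx I k)" "m \<in> N" "g = u \<otimes>\<^bsub>G\<^esub> m" "nuV m (vx J l) = vx I k"
proof -
  obtain A where A: "A \<in> GLV" "g = im A" using g by (auto simp: carrier_PGL)
  have "cls (A ` std J l) = cls (std I k)" using act A class_act_im by simp
  then obtain c where c: "c \<noteq> 0" "A ` std J l = (\<lambda>x. c \<cdot> x) ` std I k" using cls_eqD by blast
  \<comment> \<open>Absorbing the homothety into the representative leaves g unchanged and makes the
    lattices themselves correspond, not only their classes.\<close>
  define A' where "A' = (\<lambda>x. inverse c \<cdot> x) \<circ> A"
  have A'GL: "A' \<in> GLV" unfolding A'_def using c(1) by (intro GL_comp GL_scalar A(1)) simp
  have "A' ` std J l = (\<lambda>x. inverse c \<cdot> x) ` (\<lambda>x. c \<cdot> x) ` std I k"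
    unfolding A'_def image_comp[symmetric] c(2) ..
  also have "\<dots> = std I k" using c(1) by (simp add: image_image)
  finally have A'std: "A' ` std J l = std I k" .
  have "im A' = {(\<lambda>x. d \<cdot> inverse c \<cdot> A x) | d. d \<noteq> 0}" by (simp add: im_eq A'_def)
  also have "\<dots> = im A"
    unfolding im_eq
  proof safe
    fix d :: 'k assume "d \<noteq> 0"
    thus "\<exists>e. (\<lambda>x. d \<cdot> inverse c \<cdot> A x) = (\<lambda>x. e \<cdot> A x) \<and> e \<noteq> 0"
      using c(1) by (intro exI[of _ "d * inverse c"]) auto
    show "\<exists>e. (\<lambda>x. d \<cdot> A x) = (\<lambda>x. e \<cdot> inverse c \<cdot> A x) \<and> e \<noteq> 0"
      using c(1) \<open>d \<noteq> 0\<close> by (intro exI[of _ "d * c"]) auto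
  qed
  finally have gA': "g = im A'" using A(2) by simp
  obtain u w t where u: "u \<in> TV I k" "monomial smul b n t w (u \<circ> A')"
    using exists_TV_monomial[OF A'GL A'std J(2) I(2)] by blast
  define m where "m = im (u \<circ> A')"
  have mN: "m \<in> N" unfolding m_def N_grp_def using u(2) by blast
  have mg: "m = im u \<otimes>\<^bsub>G\<^esub> g" unfolding m_def gA' using im_mult[OF TV_GL[OF u(1)] A'GL] by simp
  have uU: "im u \<in> Upt (vx I k)" using TV_U_pt I u(1) by blast
  note uc = U_pt_stab[OF I uU]
  have "inv\<^bsub>G\<^esub> (im u) \<in> Upt (vx I k)" using subgroup.m_inv_closed[OF U_pt_subgroup[OF I] uU] .
  moreover have "g = inv\<^bsub>G\<^esub> (im u) \<otimes>\<^bsub>G\<^esub> m"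
    unfolding mg using group.inv_solve_left[OF group_PGL g uc(1)] g uc(1)
      monoid.m_closed[OF group.is_monoid[OF group_PGL]] by simp
  moreover have "nuV m (vx J l) = vx I k"
    using class_act_mult[OF uc(1) g] act uc(2) mg by (intro nu_vx_eqI mN J I) simp
  ultimately show ?thesis using that mN by blast
qed

subsection \<open>Points of the building as lattice classes\<close>

abbreviation "LC \<equiv> lattice_classes_bar v smul"
abbreviation "rel \<equiv> bld_rel v smul b n"

lemma PGL_closed: "g \<in> carrier G \<Longrightarrow> h \<in> carrier G \<Longrightarrow> g \<otimes>\<^bsub>G\<^esub> h \<in> carrier G"
  and PGL_inv: "g \<in> carrier G \<Longrightarrow> inv\<^bsub>G\<^esub> g \<in> carrier G"
  by (simp_all add: monoid.m_closed[OF group.is_monoid[OF group_PGL]] group.inv_closed[OF group_PGL])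

lemma class_act_inv_mult_iff:
  assumes "g \<in> carrier G" "h \<in> carrier G"
  shows "class_act (inv\<^bsub>G\<^esub> g \<otimes>\<^bsub>G\<^esub> h) (cls M) = cls M' \<longleftrightarrow> class_act h (cls M) = class_act g (cls M')"
proof -
  obtain L where L: "class_act h (cls M) = cls L" using class_act_cls assms(2) by blast
  obtain L' where L': "class_act g (cls M') = cls L'" using class_act_cls assms(1) by blast
  have "class_act (inv\<^bsub>G\<^esub> g \<otimes>\<^bsub>G\<^esub> h) (cls M) = class_act (inv\<^bsub>G\<^esub> g) (cls L)"
    using class_act_mult[OF PGL_inv[OF assms(1)] assms(2)] L by simp
  moreover have "class_act (inv\<^bsub>G\<^esub> g) (cls L) = cls M' \<longleftrightarrow> cls L = cls L'"
  proof
    assume "class_act (inv\<^bsub>G\<^esub> g) (cls L) = cls M'"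
    hence "class_act (inv\<^bsub>G\<^esub> (inv\<^bsub>G\<^esub> g)) (cls M') = cls L"
      by (rule class_act_inv[OF PGL_inv[OF assms(1)]])
    thus "cls L = cls L'" using L' group.inv_inv[OF group_PGL assms(1)] by simp
  next
    assume "cls L = cls L'"
    thus "class_act (inv\<^bsub>G\<^esub> g) (cls L) = cls M'" using class_act_inv[OF assms(1) L'] by simp
  qed
  ultimately show ?thesis using L L' by simp
qed

text \<open>The action on lattice classes is invertible, and by \<open>nu_vx_eqI\<close> it
  determines \<open>nu\<close> on vertices.\<close>

lemma nu_inv_vx:
  assumes "m \<in> N" "I \<noteq> {}" "I \<subseteq> {1..n}" "J \<noteq> {}" "J \<subseteq> {1..n}" "nuV m (vx J l) = vx I k"
  shows "nuV (inv\<^bsub>G\<^esub> m) (vx I k) = vx J l"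
proof -
  obtain J' l' where "J' \<noteq> {}" "J' \<subseteq> {1..n}" "nuV m (vx J l) = vx J' l'"
    "class_act m (cls (std J l)) = cls (std J' l')"
    using nu_vx[OF assms(1,4,5)] by blast
  moreover from this have "cls (std I k) = cls (std J' l')" using assms vx_eqD[of I k J' l'] by metis
  ultimately have "class_act m (cls (std J l)) = cls (std I k)" by simp
  hence "class_act (inv\<^bsub>G\<^esub> m) (cls (std I k)) = cls (std J l)"
    by (rule class_act_inv[OF N_carrier[OF assms(1)]])
  thus ?thesis using assms by (intro nu_vx_eqI N_inv)
qed

lemma bld_rel_vxD:
  assumes "((g, vx I k), (h, y)) \<in> rel" and I: "I \<noteq> {}" "I \<subseteq> {1..n}"
  obtains J l where "g \<in> U0" "h \<in> U0" "J \<noteq> {}" "J \<subseteq> {1..n}" "y = vx J l"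
    "class_act g (cls (std I k)) = class_act h (cls (std J l))"
proof -
  obtain m where gh: "g \<in> U0" "h \<in> U0" and m: "m \<in> N" "nuV m (vx I k) = y"
    "inv\<^bsub>G\<^esub> g \<otimes>\<^bsub>G\<^esub> h \<otimes>\<^bsub>G\<^esub> m \<in> Ppt (vx I k)"
    using assms(1) unfolding bld_rel_def by blast
  obtain J l where J: "J \<noteq> {}" "J \<subseteq> {1..n}" "nuV m (vx I k) = vx J l"
    "class_act m (cls (std I k)) = cls (std J l)"
    using nu_vx[OF m(1) I] by blast
  note gc = U0_carrier[OF gh(1)] and hc = U0_carrier[OF gh(2)] and mc = N_carrier[OF m(1)]
  have "class_act (inv\<^bsub>G\<^esub> g \<otimes>\<^bsub>G\<^esub> h \<otimes>\<^bsub>G\<^esub> m) (cls (std I k)) = cls (std I k)"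
    using P_pt_stab(2)[OF I m(3)] .
  hence "class_act (inv\<^bsub>G\<^esub> g \<otimes>\<^bsub>G\<^esub> h) (cls (std J l)) = cls (std I k)"
    using class_act_mult[OF PGL_closed[OF PGL_inv[OF gc] hc] mc] J(4) by simp
  hence "class_act g (cls (std I k)) = class_act h (cls (std J l))"
    using class_act_inv_mult_iff[OF gc hc] by simp
  thus ?thesis using that gh J m(2) by blast
qed

lemma vx_Lam_bar: "I \<noteq> {} \<Longrightarrow> I \<subseteq> {1..n} \<Longrightarrow> vx I k \<in> Lam_bar n"
  by (auto simp: Lam_bar_def Lam_def vx_def)

text \<open>\<open>class_transport\<close> is applied from the vertex of h to that of g, so that its
  unipotent factor belongs to \<open>vx I k\<close>, the point whose \<open>P_pt\<close> occurs in
  the relation. Hence the witness is the inverse of m.\<close>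

lemma bld_rel_vxI:
  assumes gh: "g \<in> U0" "h \<in> U0" and I: "I \<noteq> {}" "I \<subseteq> {1..n}" and J: "J \<noteq> {}" "J \<subseteq> {1..n}"
    and act: "class_act g (cls (std I k)) = class_act h (cls (std J l))"
  shows "((g, vx I k), (h, vx J l)) \<in> rel"
proof -
  note gc = U0_carrier[OF gh(1)] and hc = U0_carrier[OF gh(2)]
  let ?a = "inv\<^bsub>G\<^esub> g \<otimes>\<^bsub>G\<^esub> h"
  have ac: "?a \<in> carrier G" using PGL_closed PGL_inv gc hc by blast
  have "class_act ?a (cls (std J l)) = cls (std I k)"
    using class_act_inv_mult_iff[OF gc hc] act by simp
  then obtain u m where um: "u \<in> Upt (vx I k)" "m \<in> N" "?a = u \<otimes>\<^bsub>G\<^esub> m" "nuV m (vx J l) = vx I k"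
    using class_transport[OF ac _ I J] by blast
  have "?a \<otimes>\<^bsub>G\<^esub> inv\<^bsub>G\<^esub> m = u"
    unfolding um(3) using U_pt_stab(1)[OF I um(1)] N_carrier[OF um(2)]
    by (metis PGL_inv group.inv_solve_right' group.is_monoid group_PGL PGL_closed)
  hence "?a \<otimes>\<^bsub>G\<^esub> inv\<^bsub>G\<^esub> m \<in> Ppt (vx I k)" using U_pt_subset_P_pt[OF I um(1)] by simp
  moreover have "nuV (inv\<^bsub>G\<^esub> m) (vx I k) = vx J l" using nu_inv_vx[OF um(2) I J um(4)] .
  ultimately show ?thesis
    unfolding bld_rel_def using gh vx_Lam_bar I J N_inv[OF um(2)] by blast
qed

text \<open>A point of the building written down as a full equivalence class in terms of the lattice
  class, so that no representative has to be chosen; \<open>bld_rel_image\<close> justifies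
  this.\<close>

definition Phi :: "'v set set \<Rightarrow> (('v \<Rightarrow> 'v) set \<times> apt_point) set" where
  "Phi C = {(u, vx I k) | u I k. u \<in> U0 \<and> I \<noteq> {} \<and> I \<subseteq> {1..n} \<and> class_act u (cls (std I k)) = C}"

lemma bld_rel_image:
  assumes "u \<in> U0" and I: "I \<noteq> {}" "I \<subseteq> {1..n}"
  shows "rel `` {(u, vx I k)} = Phi (class_act u (cls (std I k)))"
proof (rule Set.set_eqI, rule iffI)
  fix q assume "q \<in> rel `` {(u, vx I k)}"
  then obtain h y where q: "q = (h, y)" "((u, vx I k), (h, y)) \<in> rel" by (cases q) auto
  obtain J l where "h \<in> U0" "J \<noteq> {}" "J \<subseteq> {1..n}" "y = vx J l"
    "class_act u (cls (std I k)) = class_act h (cls (std J l))"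
    using bld_rel_vxD[OF q(2) I] by metis
  thus "q \<in> Phi (class_act u (cls (std I k)))" unfolding Phi_def q(1) by auto
next
  fix q assume "q \<in> Phi (class_act u (cls (std I k)))"
  then obtain h J l where "q = (h, vx J l)" "h \<in> U0" "J \<noteq> {}" "J \<subseteq> {1..n}"
    "class_act h (cls (std J l)) = class_act u (cls (std I k))"
    unfolding Phi_def by blast
  thus "q \<in> rel `` {(u, vx I k)}" using bld_rel_vxI[OF assms(1) _ I] by simp
qed

lemma apt_embed_vx:
  assumes "I \<noteq> {}" "I \<subseteq> {1..n}" shows "apt_embed v smul b n (vx I k) = Phi (cls (std I k))"
  unfolding apt_embed_def using bld_rel_image[OF one_in_U0 assms] by (simp add: class_act_one)

section \<open>Standard form of lattice classes\<close>

lemma val_submodule_R_span: "val_submodule (R_span v smul S)"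
  unfolding val_submodule_def R_span_def
proof (intro conjI ballI allI impI)
  show "0 \<in> {\<Sum>s\<in>S. c s \<cdot> s |c. \<forall>s\<in>S. c s \<in> val_ring v}"
    by (auto simp: val_ring_iff intro!: exI[of _ "\<lambda>_. 0"])
next
  fix x y assume "x \<in> {\<Sum>s\<in>S. c s \<cdot> s |c. \<forall>s\<in>S. c s \<in> val_ring v}" "y \<in> {\<Sum>s\<in>S. c s \<cdot> s |c. \<forall>s\<in>S. c s \<in> val_ring v}"
  then obtain c d where "x = (\<Sum>s\<in>S. c s \<cdot> s)" "\<forall>s\<in>S. vge 0 (c s)" "y = (\<Sum>s\<in>S. d s \<cdot> s)" "\<forall>s\<in>S. vge 0 (d s)"
    by (auto simp: val_ring_iff)
  thus "x + y \<in> {\<Sum>s\<in>S. c s \<cdot> s |c. \<forall>s\<in>S. c s \<in> val_ring v}"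
    by (auto simp: val_ring_iff sum.distrib scale_left_distrib vge_add intro!: exI[of _ "\<lambda>s. c s + d s"])
next
  fix a x assume "vge 0 a" "x \<in> {\<Sum>s\<in>S. c s \<cdot> s |c. \<forall>s\<in>S. c s \<in> val_ring v}"
  then obtain c where "x = (\<Sum>s\<in>S. c s \<cdot> s)" "\<forall>s\<in>S. vge 0 (c s)" "vge 0 a"
    by (auto simp: val_ring_iff)
  thus "a \<cdot> x \<in> {\<Sum>s\<in>S. c s \<cdot> s |c. \<forall>s\<in>S. c s \<in> val_ring v}"
    using vge_mult[of 0 a 0]
    by (auto simp: val_ring_iff scale_sum_right intro!: exI[of _ "\<lambda>s. a * c s"])
qed

lemma R_span_bounded:
  assumes "finite S" shows "\<exists>m. R_span v smul S \<subseteq> std {1..n} (\<lambda>_. m)"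
proof -
  \<comment> \<open>The added 0 keeps the set non-empty when S is empty. The unspecified
    \<open>ord 0\<close> of vanishing coordinates can only lower the minimum.\<close>
  let ?O = "insert 0 ((\<lambda>(s, i). ord (crd s i)) ` (S \<times> {1..n}))"
  define m where "m = Min ?O"
  have m: "vge m (crd s i)" if "s \<in> S" "i \<in> {1..n}" for s i
  proof -
    have "ord (crd s i) \<in> ?O" using that by force
    moreover have "finite ?O" using assms by blast
    ultimately have "m \<le> ord (crd s i)" unfolding m_def by (intro Min_le)
    thus ?thesis by (simp add: vge_def)
  qed
  have "R_span v smul S \<subseteq> std {1..n} (\<lambda>_. m)"
  proof
    fix x assume "x \<in> R_span v smul S"
    then obtain c where c: "x = (\<Sum>s\<in>S. c s \<cdot> s)" "\<forall>s\<in>S. vge 0 (c s)"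
      by (auto simp: R_span_def val_ring_iff)
    have "vge m (crd x i)" if "i \<in> {1..n}" for i
      unfolding c(1) crd_sum crd_scale using vge_mult[of 0 _ m] c(2) m that
      by (intro vge_sum) fastforce
    thus "x \<in> std {1..n} (\<lambda>_. m)" by (simp add: std_iff)
  qed
  thus ?thesis by blast
qed

text \<open>The reduction uses integral transvections only, and these are the admissible ones at the
  origin. So u can be taken in \<open>U0\<close>, as the pairs \<open>(u, vx I k)\<close>
  representing points of the building require.\<close>

lemma lattice_class_std:
  assumes "C \<in> LC"
  obtains u I k where "u \<in> U0" "I \<noteq> {}" "I \<subseteq> {1..n}" "C = class_act u (cls (std I k))"
proof -
  obtain S where S: "finite S" "C = cls (R_span v smul S)" "R_span v smul S \<noteq> {0}"
    using assms by (auto simp: lattice_classes_bar_def R_lattice_def)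
  let ?M = "R_span v smul S"
  obtain m where m: "?M \<subseteq> std {1..n} (\<lambda>_. m)" using R_span_bounded[OF S(1)] by blast
  obtain w I k where w: "w \<in> TV {1..n} (\<lambda>_. 0)" "I \<subseteq> {1..n}" "w ` ?M = std I k"
    using exists_TV_std[OF subset_refl val_submodule_R_span m] by blast
  have "I \<noteq> {}"
  proof
    assume "I = {}"
    hence "w ` ?M = {0}" using w(3) by (auto simp: std_lattice_def)
    hence "\<forall>x\<in>?M. w x = w 0" using GL_zero[OF TV_GL[OF w(1)]] by auto
    hence "?M \<subseteq> {0}" using GL_inj[OF TV_GL[OF w(1)]] by auto
    moreover have "0 \<in> ?M" using val_submodule_R_span by (simp add: val_submodule_def)
    ultimately show False using S(3) by blast
  qed
  have wU: "im w \<in> Upt (vx {1..n} (\<lambda>_. 0))" using TV_U_pt[OF full_index w(1)] .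
  have "class_act (im w) (cls ?M) = cls (std I k)" using class_act_im[OF TV_GL[OF w(1)]] w(3) by simp
  hence "class_act (inv\<^bsub>G\<^esub> (im w)) (cls (std I k)) = C"
    using class_act_inv im_closed TV_GL w(1) S(2) by blast
  moreover have "inv\<^bsub>G\<^esub> (im w) \<in> U0"
    using subgroup.m_inv_closed[OF U_pt_subgroup[OF full_index] wU] U_pt_U0 by blast
  ultimately show ?thesis using that \<open>I \<noteq> {}\<close> w(2) by blast
qed

lemma R_lattice_std:
  assumes A: "A \<in> GLV" and I: "I \<noteq> {}" "I \<subseteq> {1..n}"
  shows "R_lattice v smul (A ` std I k)"
proof -
  let ?f = "\<lambda>i. A (\<pi> powi k i \<cdot> b i)"
  \<comment> \<open>\<open>R_span\<close> sums over a set of vectors, so a family of generators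
    indexed by I has to be injective before coefficients can be transferred.\<close>
  have inj: "inj_on ?f I"
  proof (rule inj_onI)
    fix i j assume ij: "i \<in> I" "j \<in> I" "?f i = ?f j"
    hence "\<pi> powi k i \<cdot> b i = \<pi> powi k j \<cdot> b j" using GL_inj[OF A] by blast
    hence "crd (\<pi> powi k i \<cdot> b i) i = crd (\<pi> powi k j \<cdot> b j) i" by simp
    moreover have "i \<in> {1..n}" "j \<in> {1..n}" using ij I by auto
    ultimately show "i = j" by (auto simp: crd_b split: if_splits)
  qed
  have sum: "A (\<Sum>i\<in>I. (\<pi> powi k i * c i) \<cdot> b i) = (\<Sum>i\<in>I. c i \<cdot> ?f i)" for c
    unfolding GL_sum[OF A] by (simp add: GL_scale[OF A] mult.commute)
  have "A ` std I k = R_span v smul (?f ` I)"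
  proof (rule Set.set_eqI, rule iffI)
    fix x assume "x \<in> A ` std I k"
    then obtain c where c: "x = (\<Sum>i\<in>I. c i \<cdot> ?f i)" "\<forall>i\<in>I. c i \<in> val_ring v"
      using sum by (auto simp: std_lattice_def)
    have "x = (\<Sum>s\<in>?f ` I. c (inv_into I ?f s) \<cdot> s)"
      unfolding c(1) sum.reindex[OF inj] by (intro sum.cong) (simp_all add: inv_into_f_f[OF inj])
    moreover have "\<forall>s\<in>?f ` I. c (inv_into I ?f s) \<in> val_ring v"
      using c(2) inv_into_f_f[OF inj] by auto
    ultimately show "x \<in> R_span v smul (?f ` I)"
      unfolding R_span_def mem_Collect_eq by (intro exI[of _ "\<lambda>s. c (inv_into I ?f s)"] conjI)
  next
    fix x assume "x \<in> R_span v smul (?f ` I)"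
    then obtain c where c: "x = (\<Sum>s\<in>?f ` I. c s \<cdot> s)" "\<forall>s\<in>?f ` I. c s \<in> val_ring v"
      by (auto simp: R_span_def)
    have "x = A (\<Sum>i\<in>I. (\<pi> powi k i * c (?f i)) \<cdot> b i)"
      unfolding sum c(1) sum.reindex[OF inj] by simp
    moreover have "(\<Sum>i\<in>I. (\<pi> powi k i * c (?f i)) \<cdot> b i) \<in> std I k"
      unfolding std_lattice_def mem_Collect_eq using c(2) by (intro exI[of _ "\<lambda>i. c (?f i)"]) simp
    ultimately show "x \<in> A ` std I k" by blast
  qed
  moreover have "A ` std I k \<noteq> {0}"
  proof
    assume h: "A ` std I k = {0}"
    obtain i where i: "i \<in> I" using I by blast
    have "\<pi> powi k i \<cdot> b i \<in> std I k" using std_basis_mem[OF I(2) i] by (simp add: vge_def)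
    hence "?f i \<in> A ` std I k" by (rule imageI)
    hence "?f i = A 0" by (simp only: h GL_zero[OF A] singleton_iff)
    hence "\<pi> powi k i \<cdot> b i = 0" by (simp only: GL_inj[OF A])
    thus False using b_nonzero[of i] i I(2) by auto
  qed
  moreover have "finite (?f ` I)" using I(2) finite_subset by blast
  ultimately show ?thesis unfolding R_lattice_def by blast
qed

section \<open>Equivariance, injectivity and image of \<open>Phi\<close>\<close>

lemma class_act_std_LC:
  assumes "g \<in> carrier G" "I \<noteq> {}" "I \<subseteq> {1..n}" shows "class_act g (cls (std I k)) \<in> LC"
proof -
  obtain A where "A \<in> GLV" "g = im A" using assms by (auto simp: carrier_PGL)
  thus ?thesis using class_act_im R_lattice_std assms unfolding lattice_classes_bar_def by blast
qed

lemma class_act_LC: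
  assumes "g \<in> carrier G" "C \<in> LC" shows "class_act g C \<in> LC"
proof -
  obtain u I k where u: "u \<in> U0" "I \<noteq> {}" "I \<subseteq> {1..n}" "C = class_act u (cls (std I k))"
    using lattice_class_std assms by metis
  have "class_act g C = class_act (g \<otimes>\<^bsub>G\<^esub> u) (cls (std I k))"
    using class_act_mult assms(1) U0_carrier u by simp
  thus ?thesis using class_act_std_LC PGL_closed assms(1) U0_carrier u by simp
qed

text \<open>A decomposition exists because the translated class has a standard form with u in
  \<open>U0\<close>, which \<open>class_transport\<close> compares with the product of g and u0. Its
  choice is immaterial: h fixes the class of \<open>std I k\<close> and m moves it to the class of
  the vertex \<open>nu m x\<close>, so the result always belongs to
  \<open>class_act g C\<close>.\<close>

lemma bld_act_Phi:
  assumes g: "g \<in> carrier G" and C: "C \<in> LC"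
  shows "bld_act v smul b n g (Phi C) = Phi (class_act g C)"
  unfolding bld_act_def
proof (rule the_equality)
  obtain u0 I k where u0: "u0 \<in> U0" and I: "I \<noteq> {}" "I \<subseteq> {1..n}" and Cu: "C = class_act u0 (cls (std I k))"
    using lattice_class_std[OF C] by blast
  obtain u J l where u: "u \<in> U0" and J: "J \<noteq> {}" "J \<subseteq> {1..n}"
    and gC: "class_act g C = class_act u (cls (std J l))"
    using lattice_class_std[OF class_act_LC[OF g C]] by blast
  note u0c = U0_carrier[OF u0] and uc = U0_carrier[OF u]
  have guc: "g \<otimes>\<^bsub>G\<^esub> u0 \<in> carrier G" using PGL_closed g u0c by blast
  \<comment> \<open>The transport is again directed towards \<open>vx I k\<close>. Solving for the
    product of g and u0 then yields u, the inverse of m and the inverse of h in the required order,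
    with the last factor in \<open>P_pt\<close> of that vertex.\<close>
  have "class_act (inv\<^bsub>G\<^esub> (g \<otimes>\<^bsub>G\<^esub> u0) \<otimes>\<^bsub>G\<^esub> u) (cls (std J l)) = cls (std I k)"
    using class_act_inv_mult_iff[OF guc uc] class_act_mult[OF g u0c] gC Cu by simp
  then obtain h m where hm: "h \<in> Upt (vx I k)" "m \<in> N"
    "inv\<^bsub>G\<^esub> (g \<otimes>\<^bsub>G\<^esub> u0) \<otimes>\<^bsub>G\<^esub> u = h \<otimes>\<^bsub>G\<^esub> m" "nuV m (vx J l) = vx I k"
    using class_transport[OF PGL_closed[OF PGL_inv[OF guc] uc] _ I J] by blast
  note hc = U_pt_stab(1)[OF I hm(1)] and mc = N_carrier[OF hm(2)]
  interpret grp: group G by (rule group_PGL)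
  have "u = (g \<otimes>\<^bsub>G\<^esub> u0) \<otimes>\<^bsub>G\<^esub> (h \<otimes>\<^bsub>G\<^esub> m)"
    using hm(3) grp.inv_solve_left[of "h \<otimes>\<^bsub>G\<^esub> m" "g \<otimes>\<^bsub>G\<^esub> u0" u] guc uc hc mc by simp
  hence "g \<otimes>\<^bsub>G\<^esub> u0 = u \<otimes>\<^bsub>G\<^esub> inv\<^bsub>G\<^esub> (h \<otimes>\<^bsub>G\<^esub> m)"
    using grp.inv_solve_right[of "g \<otimes>\<^bsub>G\<^esub> u0" u "h \<otimes>\<^bsub>G\<^esub> m"] guc uc hc mc by simp
  also have "\<dots> = u \<otimes>\<^bsub>G\<^esub> inv\<^bsub>G\<^esub> m \<otimes>\<^bsub>G\<^esub> inv\<^bsub>G\<^esub> h"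
    using uc hc mc by (simp add: grp.inv_mult_group grp.m_assoc)
  finally have gu0: "g \<otimes>\<^bsub>G\<^esub> u0 = u \<otimes>\<^bsub>G\<^esub> inv\<^bsub>G\<^esub> m \<otimes>\<^bsub>G\<^esub> inv\<^bsub>G\<^esub> h" .
  have "inv\<^bsub>G\<^esub> h \<in> Ppt (vx I k)"
    using subgroup.m_inv_closed[OF U_pt_subgroup[OF I] hm(1)] U_pt_subset_P_pt[OF I] by blast
  moreover have "nuV (inv\<^bsub>G\<^esub> m) (vx I k) = vx J l" using nu_inv_vx[OF hm(2) I J hm(4)] .
  moreover have "(u0, vx I k) \<in> Phi C" using u0 I Cu unfolding Phi_def by blast
  ultimately show "\<exists>u0 x u m h. (u0, x) \<in> Phi C \<and> u \<in> U0 \<and> m \<in> N \<and> h \<in> Ppt x \<and>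
      g \<otimes>\<^bsub>G\<^esub> u0 = u \<otimes>\<^bsub>G\<^esub> m \<otimes>\<^bsub>G\<^esub> h \<and> Phi (class_act g C) = rel `` {(u, nuV m x)}"
    using u N_inv[OF hm(2)] gu0 bld_rel_image[OF u J, of l] gC by metis
next
  fix \<zeta> assume "\<exists>u0 x u m h. (u0, x) \<in> Phi C \<and> u \<in> U0 \<and> m \<in> N \<and> h \<in> Ppt x \<and>
      g \<otimes>\<^bsub>G\<^esub> u0 = u \<otimes>\<^bsub>G\<^esub> m \<otimes>\<^bsub>G\<^esub> h \<and> \<zeta> = rel `` {(u, nuV m x)}"
  then obtain u0 x u m h where *: "(u0, x) \<in> Phi C" "u \<in> U0" "m \<in> N" "h \<in> Ppt x"
    "g \<otimes>\<^bsub>G\<^esub> u0 = u \<otimes>\<^bsub>G\<^esub> m \<otimes>\<^bsub>G\<^esub> h" "\<zeta> = rel `` {(u, nuV m x)}" by blast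
  obtain I k where I: "I \<noteq> {}" "I \<subseteq> {1..n}" and x: "x = vx I k" and u0: "u0 \<in> U0"
    and Cu: "class_act u0 (cls (std I k)) = C"
    using *(1) unfolding Phi_def by blast
  obtain J l where J: "J \<noteq> {}" "J \<subseteq> {1..n}" "nuV m (vx I k) = vx J l"
    "class_act m (cls (std I k)) = cls (std J l)"
    using nu_vx[OF *(3) I] by blast
  note h = P_pt_stab[OF I *(4)[unfolded x]]
  note c = U0_carrier[OF u0] U0_carrier[OF *(2)] N_carrier[OF *(3)] h(1)
  have "class_act g C = class_act (g \<otimes>\<^bsub>G\<^esub> u0) (cls (std I k))"
    using class_act_mult[OF g c(1)] Cu by simp
  also have "\<dots> = class_act u (class_act m (class_act h (cls (std I k))))"
    unfolding *(5) using class_act_mult[OF PGL_closed[OF c(2,3)] c(4)] class_act_mult[OF c(2,3)] h(2) by simp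
  finally have "class_act g C = class_act u (cls (std J l))" using h(2) J(4) by simp
  thus "\<zeta> = Phi (class_act g C)" using *(6) x J bld_rel_image[OF *(2) J(1,2)] by simp
qed

lemma Phi_bld_bar: assumes "C \<in> LC" shows "Phi C \<in> bld_bar v smul b n"
proof -
  obtain u I k where u: "u \<in> U0" and I: "I \<noteq> {}" "I \<subseteq> {1..n}" and "C = class_act u (cls (std I k))"
    using lattice_class_std[OF assms] by blast
  hence "Phi C = rel `` {(u, vx I k)}" using bld_rel_image by simp
  moreover have "(u, vx I k) \<in> U0 \<times> Lam_bar n" using u vx_Lam_bar[OF I] by blast
  ultimately show ?thesis unfolding bld_bar_def by (metis quotientI)
qed

text \<open>One common pair is enough: its vertex determines the class of the standard lattice, and
  the same u is applied to it on both sides.\<close>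

lemma Phi_inj: "inj_on Phi LC"
proof (rule inj_onI)
  fix C D assume C: "C \<in> LC" and eq: "Phi C = Phi D"
  obtain u I k where u: "u \<in> U0" "I \<noteq> {}" "I \<subseteq> {1..n}" "C = class_act u (cls (std I k))"
    using lattice_class_std[OF C] by blast
  hence "(u, vx I k) \<in> Phi D" unfolding eq[symmetric] unfolding Phi_def by blast
  then obtain J l where J: "vx I k = vx J l" "J \<noteq> {}" "J \<subseteq> {1..n}" "class_act u (cls (std J l)) = D"
    unfolding Phi_def by auto
  have "cls (std I k) = cls (std J l)" using vx_eqD[OF J(1,3)] u(2) by blast
  thus "C = D" using u(4) J(4) by simp
qed

lemma apt_vertex_iff: "apt_vertex I x \<longleftrightarrow> (\<exists>k. x = vx I k)"
proof
  assume "apt_vertex I x"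
  then obtain k :: "nat \<Rightarrow> int" where "x = lam I (\<lambda>i. real_of_int (k i))" unfolding apt_vertex_def by blast
  thus "\<exists>k. x = vx I k" by (intro exI[of _ "\<lambda>i. - k i"]) (simp add: vx_def)
next
  assume "\<exists>k. x = vx I k"
  then obtain k where "x = vx I k" by blast
  thus "apt_vertex I x" unfolding apt_vertex_def
    by (intro exI[of _ "\<lambda>i. - k i"]) (simp add: vx_def)
qed

lemma bld_act_apt_embed:
  assumes "g \<in> carrier G" "I \<noteq> {}" "I \<subseteq> {1..n}"
  shows "bld_act v smul b n g (apt_embed v smul b n (vx I k)) = Phi (class_act g (cls (std I k)))"
  using assms apt_embed_vx bld_act_Phi class_act_std_LC[OF im_closed[OF GL_id] assms(2,3), of k]
    class_act_one[of "std I k"] by (simp add: im_id)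

lemma Phi_image_LC: "Phi ` LC = vertices_bar v smul b n"
proof (rule Set.set_eqI, rule iffI)
  fix \<xi> assume "\<xi> \<in> Phi ` LC"
  then obtain C where C: "C \<in> LC" "\<xi> = Phi C" by blast
  obtain u I k where u: "u \<in> U0" "I \<noteq> {}" "I \<subseteq> {1..n}" "C = class_act u (cls (std I k))"
    using lattice_class_std[OF C(1)] by blast
  have "\<xi> = bld_act v smul b n u (apt_embed v smul b n (vx I k))"
    using bld_act_apt_embed[OF U0_carrier[OF u(1)] u(2,3)] C u(4) by simp
  moreover have "apt_vertex I (vx I k)" using apt_vertex_iff by blast
  ultimately show "\<xi> \<in> vertices_bar v smul b n"
    unfolding vertices_bar_def mem_Collect_eq using Phi_bld_bar C U0_carrier[OF u(1)] u(2,3) by metis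
next
  fix \<xi> assume "\<xi> \<in> vertices_bar v smul b n"
  then obtain g I x where g: "g \<in> carrier G" "I \<noteq> {}" "I \<subseteq> {1..n}" and x: "apt_vertex I x"
    "\<xi> = bld_act v smul b n g (apt_embed v smul b n x)" unfolding vertices_bar_def by blast
  obtain k where "x = vx I k" using x(1) apt_vertex_iff by blast
  hence "\<xi> = Phi (class_act g (cls (std I k)))" using x(2) bld_act_apt_embed[OF g] by simp
  thus "\<xi> \<in> Phi ` LC" using class_act_std_LC[OF g] by blast
qed

section \<open>Lattices of full rank and the given bijection\<close>

lemma lattice_classes_iff:
  "C \<in> lattice_classes v smul \<longleftrightarrow> (\<exists>g\<in>carrier G. \<exists>k. C = class_act g (cls (std {1..n} k)))"
proof
  assume "C \<in> lattice_classes v smul"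
  then obtain M where M: "C = cls M" "R_lattice v smul M" "span M = UNIV"
    by (auto simp: lattice_classes_def)
  hence "C \<in> LC" by (auto simp: lattice_classes_bar_def)
  then obtain u I k where u: "u \<in> U0" "I \<noteq> {}" "I \<subseteq> {1..n}" "C = class_act u (cls (std I k))"
    using lattice_class_std by blast
  obtain A where A: "A \<in> GLV" "u = im A" using U0_carrier[OF u(1)] by (auto simp: carrier_PGL)
  have "cls M = cls (A ` std I k)" using M(1) u(4) A class_act_im by simp
  then obtain c where c: "M = (\<lambda>x. c \<cdot> x) ` A ` std I k" using cls_eqD by blast
  have "{1..n} \<subseteq> I"
  proof (rule ccontr)
    assume "\<not> ?thesis"
    then obtain i where i: "i \<in> {1..n}" "i \<notin> I" by blast
    \<comment> \<open>If the index i is missing, the lattice lies in the image under A of the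
      hyperplane where coordinate i vanishes, and cannot span the whole space.\<close>
    let ?S = "{x. crd (inv_into UNIV A x) i = 0}"
    note A' = GL_inv[OF A(1)]
    have A'A: "inv_into UNIV A (A x) = x" for x
      using GL_bij[OF A(1)] bij_is_inj by (metis inv_f_f)
    have "M \<subseteq> ?S"
      using c std_crd_zero[OF _ u(3) i] by (auto simp: GL_scale[OF A'] A'A)
    moreover have "subspace ?S"
      by (auto simp: subspace_def GL_zero[OF A'] GL_add[OF A'] GL_scale[OF A'])
    ultimately have "A (b i) \<in> ?S" using span_minimal M(3) by blast
    thus False using i by (simp add: A'A crd_b)
  qed
  thus "\<exists>g\<in>carrier G. \<exists>k. C = class_act g (cls (std {1..n} k))"
    using u U0_carrier by (metis subset_antisym)
next
  assume "\<exists>g\<in>carrier G. \<exists>k. C = class_act g (cls (std {1..n} k))"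
  then obtain A k where A: "A \<in> GLV" "C = class_act (im A) (cls (std {1..n} k))"
    by (auto simp: carrier_PGL)
  let ?M = "A ` std {1..n} k"
  have "x \<in> span ?M" for x
  proof -
    obtain y where y: "x = A y" using GL_bij[OF A(1)] by (metis bij_pointE)
    have "A (b i) \<in> span ?M" if i: "i \<in> {1..n}" for i
    proof -
      have "\<pi> powi k i \<cdot> b i \<in> std {1..n} k" using std_basis_mem[OF subset_refl i] by (simp add: vge_def)
      hence "A (\<pi> powi k i \<cdot> b i) \<in> span ?M" by (intro span_base imageI)
      hence "inverse (\<pi> powi k i) \<cdot> A (\<pi> powi k i \<cdot> b i) \<in> span ?M" by (rule span_scale)
      thus ?thesis by (simp add: GL_scale[OF A(1)])
    qed
    hence "(\<Sum>i\<in>{1..n}. crd y i \<cdot> A (b i)) \<in> span ?M" by (intro span_sum span_scale)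
    thus ?thesis using GL_expand[OF A(1), of y] y by simp
  qed
  hence "span ?M = UNIV" by blast
  thus "C \<in> lattice_classes v smul"
    using A class_act_im R_lattice_std[OF A(1) full_index] unfolding lattice_classes_def by blast
qed

lemma lattice_classes_subset: "lattice_classes v smul \<subseteq> LC"
  by (auto simp: lattice_classes_def lattice_classes_bar_def)

lemma Phi_image_lattice_classes: "Phi ` lattice_classes v smul = vertices v smul b n"
proof (rule Set.set_eqI, rule iffI)
  fix \<xi> assume "\<xi> \<in> Phi ` lattice_classes v smul"
  then obtain C where C: "C \<in> lattice_classes v smul" "\<xi> = Phi C" by blast
  obtain g k where g: "g \<in> carrier G" "C = class_act g (cls (std {1..n} k))"
    using C(1) lattice_classes_iff by blast
  have "\<xi> = bld_act v smul b n g (apt_embed v smul b n (vx {1..n} k))"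
    using bld_act_apt_embed[OF g(1) full_index] C g(2) by simp
  moreover have "apt_vertex {1..n} (vx {1..n} k)" using apt_vertex_iff by blast
  moreover have "C \<in> LC" using C(1) lattice_classes_subset by blast
  ultimately show "\<xi> \<in> vertices v smul b n"
    unfolding vertices_def mem_Collect_eq using Phi_bld_bar C(2) g(1) by metis
next
  fix \<xi> assume "\<xi> \<in> vertices v smul b n"
  then obtain g x where g: "g \<in> carrier G" and x: "apt_vertex {1..n} x"
    "\<xi> = bld_act v smul b n g (apt_embed v smul b n x)" unfolding vertices_def by blast
  obtain k where "x = vx {1..n} k" using x(1) apt_vertex_iff by blast
  hence "\<xi> = Phi (class_act g (cls (std {1..n} k)))"
    using x(2) bld_act_apt_embed[OF g full_index] by simp
  thus "\<xi> \<in> Phi ` lattice_classes v smul" using lattice_classes_iff g by blast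
qed

text \<open>The definite description has a unique solution because every admissible g and k yields
  \<open>Phi C\<close>, which depends on C alone.\<close>

lemma phi_full_eq_Phi:
  assumes "C \<in> lattice_classes v smul" shows "phi_full v smul b n \<pi> C = Phi C"
proof -
  \<comment> \<open>The two coordinate vectors differ by the constant \<open>k n\<close>. The index
    n, which the sum omits, fits in because \<open>k n - k n = 0\<close>.\<close>
  have vx: "lam {1..n} (\<lambda>i. if i \<in> {1..n - 1} then real_of_int (k n - k i) else 0) = vx {1..n} k" for k
  proof -
    have "- real_of_int (k i) = (if i \<in> {1..n - 1} then real_of_int (k n - k i) else 0) + (- real_of_int (k n))"
      if "i \<in> {1..n}" for i
    proof (cases "i \<in> {1..n - 1}")
      case False
      hence "i = n" using that by auto
      thus ?thesis using False by simp
    qed simp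
    thus ?thesis unfolding vx_def lam_eq_iff by blast
  qed
  obtain g k where "g \<in> carrier G" "C = class_act g (cls (std {1..n} k))"
    using assms lattice_classes_iff by blast
  thus ?thesis unfolding phi_full_def vx
    using bld_act_apt_embed[OF _ full_index] by (intro the_equality) auto
qed

lemma class_act_lattice_classes:
  assumes "g \<in> carrier G" "C \<in> lattice_classes v smul" shows "class_act g C \<in> lattice_classes v smul"
proof -
  obtain h k where "h \<in> carrier G" "C = class_act h (cls (std {1..n} k))"
    using assms(2) lattice_classes_iff by blast
  thus ?thesis using lattice_classes_iff class_act_mult[OF assms(1)] PGL_closed[OF assms(1)] by metis
qed

end

theorem lemma5p8:
  fixes p n :: nat
    and v :: "'k::field_char_0 \<Rightarrow> ereal"
    and \<pi> :: 'k
    and smul :: "'k \<Rightarrow> 'v::ab_group_add \<Rightarrow> 'v"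
    and b :: "nat \<Rightarrow> 'v"
  assumes "prime p"
    and "finite_extension_of_Qp p v"
    and "v \<pi> = 1"
    and "vector_space smul"
    and "n \<ge> 1"
    and "is_basis smul b n"
  shows
    "bij_betw (phi_full v smul b n \<pi>) (lattice_classes v smul) (vertices v smul b n) \<and>
     (\<forall>g\<in>carrier (PGL smul). \<forall>C\<in>lattice_classes v smul.
        phi_full v smul b n \<pi> (class_act g C) = bld_act v smul b n g (phi_full v smul b n \<pi> C)) \<and>
     (\<forall>C\<in>lattice_classes_bar v smul. \<exists>g\<in>carrier (PGL smul). \<exists>I k. I \<noteq> {} \<and> I \<subseteq> {1..n} \<and>
        C = class_act g (homothety_class smul (std_lattice v smul b \<pi> I k))) \<and>
     (\<exists>\<phi>. (\<forall>C\<in>lattice_classes v smul. \<phi> C = phi_full v smul b n \<pi> C) \<and>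
        bij_betw \<phi> (lattice_classes_bar v smul) (vertices_bar v smul b n) \<and>
        (\<forall>g\<in>carrier (PGL smul). \<forall>C\<in>lattice_classes_bar v smul.
           \<phi> (class_act g C) = bld_act v smul b n g (\<phi> C)) \<and>
        (\<forall>g\<in>carrier (PGL smul). \<forall>I k. I \<noteq> {} \<and> I \<subseteq> {1..n} \<longrightarrow>
           \<phi> (class_act g (homothety_class smul (std_lattice v smul b \<pi> I k))) =
             bld_act v smul b n g (apt_embed v smul b n (lam I (\<lambda>i. - real_of_int (k i))))))"
proof -
  have "normalized_valuation v" using assms(2) by (simp add: finite_extension_of_Qp_def)
  then interpret pgl_lattices smul v \<pi> b n
    using assms by (intro pgl_lattices.intro pgl_lattices_axioms.intro)
  have inj: "inj_on Phi (lattice_classes v smul)"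
    using Phi_inj lattice_classes_subset by (rule inj_on_subset)
  have "bij_betw (phi_full v smul b n \<pi>) (lattice_classes v smul) (vertices v smul b n)"
    using inj Phi_image_lattice_classes phi_full_eq_Phi
    by (subst bij_betw_cong[of _ _ Phi]) (simp_all add: bij_betw_def)
  moreover have "phi_full v smul b n \<pi> (class_act g C) = bld_act v smul b n g (phi_full v smul b n \<pi> C)"
    if "g \<in> carrier G" "C \<in> lattice_classes v smul" for g C
    using that class_act_lattice_classes lattice_classes_subset bld_act_Phi
    by (simp add: phi_full_eq_Phi subset_iff)
  moreover have "\<exists>g\<in>carrier G. \<exists>I k. I \<noteq> {} \<and> I \<subseteq> {1..n} \<and> C = class_act g (cls (std I k))"
    if "C \<in> LC" for C
    using lattice_class_std[OF that] U0_carrier by metis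
  moreover have "bij_betw Phi LC (vertices_bar v smul b n)"
    using Phi_inj Phi_image_LC by (simp add: bij_betw_def)
  moreover have "Phi (class_act g (cls (std I k))) =
      bld_act v smul b n g (apt_embed v smul b n (lam I (\<lambda>i. - real_of_int (k i))))"
    if "g \<in> carrier G" "I \<noteq> {}" "I \<subseteq> {1..n}" for g I k
    using bld_act_apt_embed[OF that] by (simp add: vx_def)
  ultimately show ?thesis using phi_full_eq_Phi bld_act_Phi
    by (intro conjI ballI exI[of _ Phi] allI impI) auto
qed

end
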